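(* Let $r$ and $s$ be two positive integers with $r+s\equiv 0 \pmod{24}$. Let $\tau$ be in the upper half-plane and $q=e^{2\pi i\tau}$. If $r+s\equiv 0\pmod 5$, then $$T_5\big(\eta(r\tau)\eta(s\tau)\big)=\eta(r\tau)\eta(s\tau)\left(q^{-(r+s)/60}U(r,s)\right)^2,$$ and if $r-s\equiv 0\pmod 5$, then $$T_5\big(\eta(r\tau)\eta(s\tau)\big)=-\eta(r\tau)\eta(s\tau)\left(q^{(11r-s)/60}U(r,s)\right)^2 .$$
   Context: For $|q|<1$, $(a;q)_\infty=\prod_{k\ge0}(1-aq^k)$ and $(a;q)_n=\prod_{k=0}^{n-1}(1-aq^k)$. The Rogers--Ramanujan functions are $G(q)=\sum_{n\ge0}\frac{q^{n^2}}{(q;q)_n}=\frac{1}{(q;q^5)_\infty(q^4;q^5)_\infty}$ and $H(q)=\sum_{n\ge0}\frac{q^{n(n+1)}}{(q;q)_n}=\frac{1}{(q^2;q^5)_\infty(q^3;q^5)_\infty}$. For positive integers $r,s$, $$U(r,s)=U(r,s,q)=\begin{cases} G(q^r)G(q^s)+q^{(s+r)/5}H(q^r)H(q^s) & \text{if } s+r\equiv0\pmod5,\\ H(q^r)G(q^s)-q^{(s-r)/5}G(q^r)H(q^s) & \text{if } s-r\equiv 0\pmod 5.\end{cases}$$ The Dedekind eta function is $\eta(\tau)=\sum_{n=-\infty}^{\infty}(-1)^nq^{(6n-1)^2/24}=q^{1/24}(q;q)_\infty$ with $q=e^{2\pi i\tau}$, $\operatorname{Im}\tau>0$. For a $q$-series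 $\sum_{n\ge0}a(n)q^n$, the Hecke operator $T_5$ is $T_5\left(\sum_{n\ge0}a(n)q^n\right)=\sum_{n\ge0}\big(a(5n)+a(n/5)\big)q^n$, where $a(k)=0$ if $k$ is not an integer.
   Formalization: The case where 5 divides both r and s is excluded: there both congruences hold, the two formulas for U(r,s) conflict, and the identities fail (e.g. r = s = 60). *)

theory Defs
  imports "HOL-Analysis.Analysis" "HOL-Number_Theory.Cong"
begin

definition qpoch :: "complex \<Rightarrow> complex \<Rightarrow> nat \<Rightarrow> complex" where
  "qpoch a q n = (\<Prod>k<n. 1 - a * q ^ k)"

definition qpoch_inf :: "complex \<Rightarrow> complex \<Rightarrow> complex" where
  "qpoch_inf a q = (\<Prod>k. 1 - a * q ^ k)"

definition RR_G :: "complex \<Rightarrow> complex" where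
  "RR_G q = (\<Sum>n. q ^ (n ^ 2) / qpoch q q n)"

definition RR_H :: "complex \<Rightarrow> complex" where
  "RR_H q = (\<Sum>n. q ^ (n * (n + 1)) / qpoch q q n)"

text \<open>
  Both divisions below are exact in their branches. The two congruences hold simultaneously
  precisely when 5 divides both \<open>r\<close> and \<open>s\<close>; the two formulas then disagree, so the value of
  \<open>RR_U\<close> is only meaningful outside that case.
\<close>

definition RR_U :: "nat \<Rightarrow> nat \<Rightarrow> complex \<Rightarrow> complex" where
  "RR_U r s q =
    (if [s + r = 0] (mod 5) then
       RR_G (q ^ r) * RR_G (q ^ s) + q ^ ((s + r) div 5) * RR_H (q ^ r) * RR_H (q ^ s)
     else if [int s - int r = 0] (mod 5) then
       RR_H (q ^ r) * RR_G (q ^ s)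
         - q powi ((int s - int r) div 5) * RR_G (q ^ r) * RR_H (q ^ s)
     else undefined)"

text \<open>
  The power \<open>q\<^sup>x\<close> for \<open>q = exp (2\<pi>i\<tau>)\<close> and real \<open>x\<close>. The branch is determined by \<open>\<tau>\<close>, not
  by the principal logarithm of \<open>q\<close>.
\<close>

definition q_pow :: "complex \<Rightarrow> real \<Rightarrow> complex" where
  "q_pow \<tau> x = exp (2 * of_real pi * \<i> * \<tau> * of_real x)"

definition dedekind_eta :: "complex \<Rightarrow> complex" where
  "dedekind_eta \<tau> = q_pow \<tau> (1 / 24) * qpoch_inf (q_pow \<tau> 1) (q_pow \<tau> 1)"

definition has_q_expansion :: "(complex \<Rightarrow> complex) \<Rightarrow> (nat \<Rightarrow> complex) \<Rightarrow> bool" where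
  "has_q_expansion f a \<longleftrightarrow> (\<forall>\<tau>. Im \<tau> > 0 \<longrightarrow> (\<lambda>n. a n * q_pow \<tau> 1 ^ n) sums f \<tau>)"

lemma has_q_expansion_unique:
  assumes "has_q_expansion f a" "has_q_expansion f b"
  shows   "a = b"
proof (rule ccontr)
  assume "a \<noteq> b"
  define c where "c = (\<lambda>n. a n - b n)"
  have sums_0: "(\<lambda>n. c n * z ^ n) sums 0" if z: "z \<noteq> 0" "norm z < 1" for z
  proof -
    define \<tau> where "\<tau> = Ln z / (2 * of_real pi * \<i>)"
    have "Im \<tau> = - ln (norm z) / (2 * pi)"
      using z by (simp add: \<tau>_def Im_divide power2_eq_square)
    also have "\<dots> > 0"
      using z by (simp add: divide_neg_pos)
    finally have "Im \<tau> > 0" .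
    moreover have "q_pow \<tau> 1 = z"
      using z by (simp add: q_pow_def \<tau>_def)
    ultimately have "(\<lambda>n. a n * z ^ n) sums f \<tau>" "(\<lambda>n. b n * z ^ n) sums f \<tau>"
      using assms by (auto simp: has_q_expansion_def)
    from sums_diff[OF this] show ?thesis
      by (simp add: c_def algebra_simps)
  qed
  obtain m where m: "c m \<noteq> 0" "\<And>k. k < m \<Longrightarrow> c k = 0"
    proof -
    obtain k where "c k \<noteq> 0"
      using \<open>a \<noteq> b\<close> by (auto simp: c_def fun_eq_iff)
    thus ?thesis
      using that[of "LEAST n. c n \<noteq> 0"] LeastI[of "\<lambda>n. c n \<noteq> 0" k] not_less_Least by blast
  qed
  define d where "d = (\<lambda>n. c (n + m))"
  have d_sums: "(\<lambda>n. d n * z ^ n) sums 0" if z: "z \<noteq> 0" "norm z < 1" for z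
  proof -
    have "(\<lambda>n. c (n + m) * z ^ (n + m)) sums 0"
      using sums_0[OF z] m(2) by (subst sums_iff_shift) simp
    from sums_divide[OF this, of "z ^ m"] show ?thesis
      using z by (simp add: d_def power_add)
  qed
  have d_summable: "summable (\<lambda>n. d n * z ^ n)" if "norm z < 1" for z
    using d_sums[of z] that by (cases "z = 0") (auto simp: sums_iff)
  have "((\<lambda>z. \<Sum>n. d n * z ^ n) \<longlongrightarrow> d 0) (at 0)"
    by (rule powser_limit_0_strong[of 1]) (use d_summable in \<open>auto intro: summable_sums\<close>)
  moreover have "eventually (\<lambda>z. (\<Sum>n. d n * z ^ n) = 0) (at 0)"
    unfolding eventually_at by (rule exI[of _ 1]) (use d_sums in \<open>auto simp: sums_iff\<close>)
  ultimately have "d 0 = 0"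
    using tendsto_unique[OF _ _ tendsto_eventually, of "at 0"] by force
  with m show False by (simp add: d_def)
qed

definition hecke_T5_coeff :: "(nat \<Rightarrow> complex) \<Rightarrow> nat \<Rightarrow> complex" where
  "hecke_T5_coeff a n = a (5 * n) + (if 5 dvd n then a (n div 5) else 0)"

definition hecke_T5 :: "(complex \<Rightarrow> complex) \<Rightarrow> complex \<Rightarrow> complex" where
  "hecke_T5 f \<tau> =
    (let a = (THE a. has_q_expansion f a) in \<Sum>n. hecke_T5_coeff a n * q_pow \<tau> 1 ^ n)"

end

theory Submission imports Defs begin

text \<open>
  Write \<open>E(q) = (q;q)\<^sub>\<infinity>\<close>. Everything follows from two identities,
  \<open>E(q\<^sup>5) = E(q) G(q) H(q)\<close> and the 5-dissection
  \<open>E(q) = E(q\<^sup>5) (G\<^sup>2 - q G H - q\<^sup>2 H\<^sup>2)\<close> with \<open>G\<close> and \<open>H\<close> taken at \<open>q\<^sup>5\<close>. If \<open>r + s = 24 N\<close>, then of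
  the nine terms in the product of the dissections of \<open>E(q\<^sup>r)\<close> and \<open>E(q\<^sup>s)\<close> exactly three have an
  exponent that, after adding \<open>N\<close>, is divisible by 5. These three and the term
  \<open>q\<^sup>5\<^sup>N E(q\<^sup>5\<^sup>r) E(q\<^sup>5\<^sup>s)\<close> of the Hecke operator form a perfect square.

  The first identity comes from the Rogers--Ramanujan identities, proved by iterating Bailey's
  lemma on the finite form of the Jacobi triple product. The dissection is Euler's
  pentagonal number theorem split modulo 5 and summed by the quintuple product identity.
\<close>

text \<open>The square rests on one coincidence: the middle term of the dissection of E(q) is - q
  E(q^25), because E(q^25) = E(q^5) G H at q^5. Let y be a fifth root of q. Since 25 N = N + r + s,
  the second summand of the Hecke operator equals y^N times the product of the two middle terms.
  That product already occurs once among the three surviving terms, and its second copy completes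
  the double cross term of a binomial square. The outer terms of the dissection carry opposite
  signs. If 5 divides r + s, equal residue classes meet and the square comes with a plus sign; if 5
  divides r - s, the class of G^2 meets that of H^2, whence the minus sign of the second formula.
  Sums run over all integers, with 1/(q;q)_k read as 0 for k < 0, so index shifts and reflections
  leave no boundary terms. Limits are then taken by dominated convergence for unordered
  sums.\<close>

lemma infsum_dominated_convergence:
  fixes f :: "nat \<Rightarrow> 'b \<Rightarrow> complex" and g :: "'b \<Rightarrow> complex" and M :: "'b \<Rightarrow> real"
  assumes lim: "\<And>x. (\<lambda>n. f n x) \<longlonglongrightarrow> g x"
    and bound: "\<And>n x. norm (f n x) \<le> M x"
    and M: "M summable_on UNIV"
  shows "(\<lambda>n. infsum (f n) UNIV) \<longlonglongrightarrow> infsum g UNIV"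
proof -
  have M0: "M x \<ge> 0" for x
    using bound[of 0 x] norm_ge_zero order_trans by blast
  have Mabs: "(\<lambda>x. norm (M x)) summable_on UNIV"
    using M M0 by (simp add: real_norm_def)
  have fabs: "(\<lambda>x. norm (f n x)) summable_on UNIV" for n
    by (rule summable_on_comparison_test[OF M]) (use bound in auto)
  have g_le: "norm (g x) \<le> M x" for x
    by (rule Lim_bounded[OF tendsto_norm[OF lim[of x]], of 0]) (use bound in auto)
  have gabs: "(\<lambda>x. norm (g x)) summable_on UNIV"
    by (rule summable_on_comparison_test[OF M]) (use g_le in auto)
  \<comment> \<open>Unordered sums are integrals over the counting measure, where Lebesgue's theorem
    applies; this gives Tannery's theorem.\<close>
  have "(\<lambda>n. infsetsum (f n) UNIV) \<longlonglongrightarrow> infsetsum g UNIV"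
    unfolding infsetsum_def
  proof (rule integral_dominated_convergence[where w = M])
    show "integrable (count_space UNIV) M"
      using Mabs abs_summable_equivalent[of M UNIV] unfolding Infinite_Set_Sum.abs_summable_on_def by blast
  qed (use lim bound in auto)
  thus ?thesis
    using fabs gabs by (simp add: infsetsum_infsum abs_summable_equivalent)
qed

section \<open>Theta series\<close>

definition tri :: "int \<Rightarrow> int" where
  "tri n = n * (n - 1) div 2"

lemma two_tri: "2 * tri n = n * n - n"
  by (simp add: tri_def right_diff_distrib)

lemma tri_eqI: "2 * e = n * n - n \<Longrightarrow> tri n = e"
  using two_tri[of n] by linarith

lemma tri_0 [simp]: "tri 0 = 0" and tri_1 [simp]: "tri 1 = 0"
  by (simp_all add: tri_def)

lemma tri_add: "tri (m + n) = tri m + tri n + m * n"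
  using two_tri[of m] two_tri[of n] by (intro tri_eqI) (simp add: algebra_simps)

lemma tri_uminus: "tri (- n) = tri n + n"
  using two_tri[of n] by (intro tri_eqI) (simp add: algebra_simps)

text \<open>Jacobi's summand with exponent n (n - 1) / 2, so that all powers are integral; the
  symmetric exponent n^2 / 2 would call for a square root of \<open>p\<close>.\<close>

definition theta_term :: "complex \<Rightarrow> complex \<Rightarrow> int \<Rightarrow> complex" where
  "theta_term p z n = p powi tri n * z powi n"

definition theta :: "complex \<Rightarrow> complex \<Rightarrow> complex" where
  "theta p z = infsum (theta_term p z) UNIV"

lemma theta_term_0 [simp]: "theta_term p z 0 = 1"
  by (simp add: theta_term_def)

lemma theta_term_add_1:
  assumes "p \<noteq> 0" "z \<noteq> 0"
  shows "theta_term p z (n + 1) = p powi n * z * theta_term p z n"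
  using assms tri_add[of n 1] by (simp add: theta_term_def power_int_add)

lemma theta_term_uminus:
  assumes "p \<noteq> 0" "z \<noteq> 0"
  shows "theta_term p z (- n) = theta_term p (p / z) n"
  using assms unfolding theta_term_def tri_uminus
  by (simp add: power_int_add power_int_divide_distrib power_int_minus field_simps)

text \<open>The ratio of consecutive terms is p^k z, which tends to 0 however large \<open>z\<close>
  is.\<close>

lemma summable_theta_term_nat:
  assumes "p \<noteq> 0" "z \<noteq> 0" "norm p < 1"
  shows "summable (\<lambda>k. norm (theta_term p z (int k)))"
proof -
  have "(\<lambda>k. norm p ^ k * norm z) \<longlonglongrightarrow> 0 * norm z"
    by (intro tendsto_intros LIMSEQ_power_zero) (use assms in auto)
  hence "eventually (\<lambda>k. norm p ^ k * norm z < 1 / 2) sequentially"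
    by (intro order_tendstoD(2)[of _ "0 * norm z"]) auto
  then obtain N where N: "\<And>k. k \<ge> N \<Longrightarrow> norm p ^ k * norm z < 1 / 2"
    by (auto simp: eventually_sequentially)
  show ?thesis
  proof (rule summable_ratio_test[of "1/2" N])
    fix k assume "k \<ge> N"
    have "norm (theta_term p z (int (Suc k))) = (norm p ^ k * norm z) * norm (theta_term p z (int k))"
      using theta_term_add_1[of p z "int k"] assms by (simp add: norm_mult norm_power add.commute)
    also have "\<dots> \<le> 1 / 2 * norm (theta_term p z (int k))"
      using N[OF \<open>k \<ge> N\<close>] by (intro mult_right_mono) auto
    finally show "norm (norm (theta_term p z (int (Suc k)))) \<le> 1 / 2 * norm (norm (theta_term p z (int k)))"
      by simp
  qed auto
qed

text \<open>The negative half-line is the nonnegative half-line for \<open>p / z\<close>, by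
  \<open>theta_term_uminus\<close>.\<close>

lemma abs_summable_theta_term:
  assumes "p \<noteq> 0" "z \<noteq> 0" "norm p < 1"
  shows "(\<lambda>n. norm (theta_term p z n)) summable_on A"
proof -
  have *: "(\<lambda>k. norm (theta_term p w (int k))) summable_on UNIV" if "w \<noteq> 0" for w
    using summable_theta_term_nat[of p w] assms that
    by (subst summable_on_UNIV_nonneg_real_iff) auto
  have "(\<lambda>n. norm (theta_term p z n)) summable_on range int"
    using *[of z] assms by (subst summable_on_reindex) (auto simp: o_def)
  moreover have "(\<lambda>n. norm (theta_term p z n)) summable_on range (\<lambda>k. - int k)"
    using *[of "p / z"] assms by (subst summable_on_reindex) (auto simp: o_def inj_def theta_term_uminus)
  ultimately have "(\<lambda>n. norm (theta_term p z n)) summable_on (range int \<union> range (\<lambda>k. - int k))"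
    by (rule summable_on_union)
  moreover have "range int \<union> range (\<lambda>k. - int k) = UNIV"
  proof (intro equalityI subsetI)
    fix n :: int
    show "n \<in> range int \<union> range (\<lambda>k. - int k)"
      by (cases n rule: int_cases2) auto
  qed auto
  ultimately show ?thesis
    using summable_on_subset_banach[OF _ subset_UNIV] by metis
qed

lemma summable_theta_term:
  assumes "p \<noteq> 0" "z \<noteq> 0" "norm p < 1"
  shows "theta_term p z summable_on A"
  by (rule abs_summable_summable) (rule abs_summable_theta_term[OF assms])

lemma has_sum_theta:
  assumes "p \<noteq> 0" "z \<noteq> 0" "norm p < 1"
  shows "(theta_term p z has_sum theta p z) UNIV"
  unfolding theta_def by (rule has_sum_infsum) (rule summable_theta_term[OF assms])

lemma theta_reflect:
  assumes "p \<noteq> 0" "z \<noteq> 0"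
  shows "theta p (p / z) = theta p z"
  unfolding theta_def
  by (rule infsum_reindex_bij_witness[of _ uminus uminus])
     (auto simp: theta_term_uminus[OF assms, symmetric])

section \<open>Reciprocals of q-factorials\<close>

text \<open>The value 0 at negative \<open>k\<close> is the one forced by the recurrence
  \<open>inv_qfact_pred\<close>; it truncates sums over all integers automatically.\<close>

definition inv_qfact :: "complex \<Rightarrow> int \<Rightarrow> complex" where
  "inv_qfact q k = (if k < 0 then 0 else 1 / qpoch q q (nat k))"

lemma qpoch_0 [simp]: "qpoch a q 0 = 1"
  by (simp add: qpoch_def)

lemma qpoch_Suc: "qpoch a q (Suc n) = qpoch a q n * (1 - a * q ^ n)"
  by (simp add: qpoch_def)

lemma power_neq_1:
  fixes q :: complex
  assumes "norm q < 1" "n > 0"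
  shows "q ^ n \<noteq> 1"
proof
  assume "q ^ n = 1"
  hence "norm q ^ n = 1"
    by (metis norm_one norm_power)
  thus False
    using assms power_less_one_iff[of "norm q" n] by simp
qed

lemma qpoch_self_nonzero:
  assumes "norm q < 1"
  shows "qpoch q q n \<noteq> 0"
proof -
  have "q * q ^ k \<noteq> 1" for k
    using power_neq_1[OF assms, of "Suc k"] by simp
  thus ?thesis by (simp add: qpoch_def)
qed

lemma inv_qfact_neg [simp]: "k < 0 \<Longrightarrow> inv_qfact q k = 0"
  and inv_qfact_0 [simp]: "inv_qfact q 0 = 1"
  by (auto simp: inv_qfact_def)

lemma inv_qfact_int: "inv_qfact q (int n) = 1 / qpoch q q n"
  by (simp add: inv_qfact_def)

text \<open>Valid for every integer \<open>k\<close>: at k = 0 the factor 1 - q^0 vanishes, as the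
  left-hand side does.\<close>

lemma inv_qfact_pred:
  assumes "norm q < 1"
  shows "inv_qfact q (k - 1) = (1 - q powi k) * inv_qfact q k"
proof (cases "k \<le> 0")
  case True
  thus ?thesis by (cases "k = 0") auto
next
  case False
  then obtain n where n: "k = int (Suc n)"
    by (metis not_le zero_less_imp_eq_int gr0_conv_Suc)
  have "qpoch q q n \<noteq> 0" "qpoch q q (Suc n) \<noteq> 0"
    using assms by (simp_all only: qpoch_self_nonzero not_False_eq_True)
  thus ?thesis
    unfolding n by (simp add: inv_qfact_def nat_add_distrib power_int_def qpoch_Suc divide_simps)
qed

lemma convergent_prod_qpoch:
  fixes a q :: complex
  assumes "norm q < 1"
  shows "convergent_prod (\<lambda>k. 1 - a * q ^ k)"
proof -
  have "summable (\<lambda>k. norm a * norm q ^ k)"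
    using assms by (intro summable_mult summable_geometric) auto
  hence "summable (\<lambda>k. norm ((1 - a * q ^ k) - 1))"
    by (simp add: norm_mult norm_power)
  thus ?thesis
    by (intro abs_convergent_prod_imp_convergent_prod summable_imp_abs_convergent_prod)
qed

lemma qpoch_tendsto:
  assumes "norm q < 1"
  shows "(\<lambda>n. qpoch a q n) \<longlonglongrightarrow> qpoch_inf a q"
proof -
  have "(\<lambda>n. qpoch a q (Suc n)) \<longlonglongrightarrow> qpoch_inf a q"
    using convergent_prod_LIMSEQ[OF convergent_prod_qpoch[OF assms, of a]]
    unfolding qpoch_def qpoch_inf_def lessThan_Suc_atMost .
  thus ?thesis by (rule LIMSEQ_imp_Suc)
qed

lemma qpoch_inf_nonzero:
  assumes "norm q < 1" "\<And>k. a * q ^ k \<noteq> 1"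
  shows "qpoch_inf a q \<noteq> 0"
  unfolding qpoch_inf_def
  by (rule prodinf_nonzero[OF convergent_prod_qpoch[OF assms(1)]]) (use assms(2) in auto)

lemma qpoch_inf_self_nonzero: "norm q < 1 \<Longrightarrow> qpoch_inf q q \<noteq> 0"
  using power_neq_1[of q "Suc k" for k] by (intro qpoch_inf_nonzero) auto

lemma inv_qfact_tendsto:
  assumes "norm q < 1"
  shows "(\<lambda>n. inv_qfact q (int n)) \<longlonglongrightarrow> 1 / qpoch_inf q q"
  unfolding inv_qfact_int
  by (intro tendsto_intros qpoch_tendsto qpoch_inf_self_nonzero assms)

lemma inv_qfact_shift_tendsto:
  assumes "norm q < 1"
  shows "(\<lambda>n. inv_qfact q (int n + k)) \<longlonglongrightarrow> 1 / qpoch_inf q q"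
proof -
  have "filterlim (\<lambda>n. nat (int n + k)) sequentially sequentially"
    unfolding filterlim_at_top
  proof
    fix Z
    show "eventually (\<lambda>n. Z \<le> nat (int n + k)) sequentially"
      using eventually_ge_at_top[of "nat (int Z - k)"] by eventually_elim linarith
  qed
  hence "(\<lambda>n. inv_qfact q (int (nat (int n + k)))) \<longlonglongrightarrow> 1 / qpoch_inf q q"
    by (rule filterlim_compose[OF inv_qfact_tendsto[OF assms]])
  moreover have "eventually (\<lambda>n. inv_qfact q (int (nat (int n + k))) = inv_qfact q (int n + k)) sequentially"
    using eventually_ge_at_top[of "nat (- k)"] by eventually_elim simp
  ultimately show ?thesis
    using tendsto_cong by fast
qed

lemma inv_qfact_bounded:
  assumes "norm q < 1"
  obtains K where "K > 0" "\<And>k. norm (inv_qfact q k) \<le> K"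
proof -
  have "Bseq (\<lambda>n. inv_qfact q (int n))"
    using inv_qfact_tendsto[OF assms] by (intro convergent_imp_Bseq convergentI)
  then obtain K where K: "K > 0" "\<And>n. norm (inv_qfact q (int n)) \<le> K"
    by (auto simp: Bseq_def)
  have "norm (inv_qfact q k) \<le> K" for k
    using K(1) K(2)[of "nat k"] by (cases "k < 0") auto
  with K(1) that show ?thesis by blast
qed

section \<open>The Bailey chain\<close>

lemma has_sum_shift_int:
  fixes f :: "int \<Rightarrow> complex"
  assumes "(f has_sum S) UNIV"
  shows "((\<lambda>r. f (r + k)) has_sum S) UNIV"
  using assms
  by (subst has_sum_reindex_bij_witness[of UNIV "\<lambda>r. r - k" "\<lambda>r. r + k" UNIV]) auto

lemma has_sum_sum:
  fixes f :: "'i \<Rightarrow> 'b \<Rightarrow> complex"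
  assumes "\<And>i. i \<in> I \<Longrightarrow> (f i has_sum S i) A"
  shows "((\<lambda>x. \<Sum>i\<in>I. f i x) has_sum (\<Sum>i\<in>I. S i)) A"
  using assms by (induction I rule: infinite_finite_induct) (auto intro!: has_sum_add)

text \<open>Passing from n to n + 1 multiplies the product side by (1 + z q^n) (1 + q^(n+1) / z) = 1
  + q^(2n+1) + z q^n + q^(n+1) / z. The last two monomials correspond to shifting the summation
  index by -1 and by 1, which does not change the sum.\<close>

lemma finite_triple_product:
  assumes "q \<noteq> 0" "norm q < 1" "z \<noteq> 0"
  shows "((\<lambda>r. theta_term q z r * inv_qfact q (int n - r) * inv_qfact q (int n + r)) has_sum
           qpoch (- z) q n * qpoch (- q / z) q n * inv_qfact q (2 * int n)) UNIV"
proof (induction n)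
  case 0
  show ?case
    by (rule has_sum_finite_neutralI[of "{0}"]) (auto simp: inv_qfact_def)
next
  case (Suc n)
  define N where "N = int n + 1"
  define T where "T = theta_term q z"
  define c where "c = inv_qfact q"
  define S where "S = qpoch (- z) q n * qpoch (- q / z) q n * c (2 * int n)"
  have c_pred: "c (k - 1) = (1 - q powi k) * c k" for k
    unfolding c_def by (rule inv_qfact_pred) (use assms in auto)
  define f where "f = (\<lambda>r. T r * c (int n - r) * c (int n + r))"
  have f: "(f has_sum S) UNIV"
    using Suc.IH by (simp add: f_def S_def T_def c_def)
  define A where "A = (1 - q powi (2 * N)) * (1 - q powi (2 * N - 1))"
  have c2n: "c (2 * int n) = A * c (2 * N)"
    using c_pred[of "2 * N"] c_pred[of "2 * N - 1"] by (simp add: N_def A_def)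
  have A: "A \<noteq> 0"
    using power_neq_1[OF assms(2), of "2 * Suc n"] power_neq_1[OF assms(2), of "2 * n + 1"]
    unfolding A_def N_def by (simp add: power_int_def nat_add_distrib nat_mult_distrib)
  have pointwise: "A * (T r * c (N - r) * c (N + r)) =
      (1 + q powi (2 * N - 1)) * f r + z * q ^ n * f (r + -1) + q ^ Suc n / z * f (r + 1)" for r
  proof -
    \<comment> \<open>In these variables all terms are multiples of T r * c (N - r) * c (N + r), and
      what remains is a polynomial identity in x, y and 1/q.\<close>
    define x y where "x = q powi (N - r)" and "y = q powi (N + r)"
    have xy: "q powi (2 * N) = x * y"
      using power_int_add[of q "N - r" "N + r"] assms by (simp add: x_def y_def)
    have xy': "q powi (2 * N - 1) = x * y / q"
      using assms by (simp add: power_int_diff xy)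
    have T1: "z * q ^ n * T (r + -1) = x * T r"
    proof -
      have "T r = q powi (r - 1) * z * T (r + -1)"
        unfolding T_def using theta_term_add_1[of q z "r - 1"] assms by simp
      moreover have "q ^ n = x * q powi (r - 1)"
        unfolding x_def using assms by (simp add: N_def flip: power_int_add power_int_of_nat)
      ultimately show ?thesis by simp
    qed
    have T2: "q ^ Suc n / z * T (r + 1) = y * T r"
    proof -
      have "y = q ^ Suc n * q powi r"
        unfolding y_def N_def using assms by (simp add: power_int_add algebra_simps)
      thus ?thesis
        unfolding T_def using theta_term_add_1[of q z r] assms by simp
    qed
    have c1: "c (int n - r) = (1 - x) * c (N - r)"
      using c_pred[of "N - r"] by (simp add: N_def x_def)
    have c2: "c (int n + r) = (1 - y) * c (N + r)"
      using c_pred[of "N + r"] by (simp add: N_def y_def algebra_simps)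
    have c3: "c (int n + (r + -1)) = (1 - y / q) * (1 - y) * c (N + r)"
    proof -
      have "c (int n + (r + -1)) = (1 - q powi (int n + r)) * c (int n + r)"
        using c_pred[of "int n + r"] by (simp add: add_diff_eq)
      moreover have "q powi (int n + r) = y / q"
        using power_int_diff[of q "N + r" 1] assms by (simp add: y_def N_def)
      ultimately show ?thesis
        unfolding c2 by simp
    qed
    have c4: "c (int n - (r + 1)) = (1 - x / q) * (1 - x) * c (N - r)"
    proof -
      have "c (int n - (r + 1)) = (1 - q powi (int n - r)) * c (int n - r)"
        using c_pred[of "int n - r"] by (simp add: diff_diff_eq)
      moreover have "q powi (int n - r) = x / q"
        using power_int_diff[of q "N - r" 1] assms by (simp add: x_def N_def)
      ultimately show ?thesis
        unfolding c1 by simp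
    qed
    have c5: "c (int n - (r + -1)) = c (N - r)" "c (int n + (r + 1)) = c (N + r)"
      by (simp_all add: N_def algebra_simps)
    have f1: "z * q ^ n * f (r + -1) = x * T r * c (N - r) * ((1 - y / q) * (1 - y) * c (N + r))"
      unfolding f_def c3 c5 using T1 by (simp add: mult.assoc)
    have f2: "q ^ Suc n / z * f (r + 1) = y * T r * ((1 - x / q) * (1 - x) * c (N - r)) * c (N + r)"
      by (simp only: f_def c4 c5 mult.assoc[symmetric] T2)
    show ?thesis
      unfolding f1 f2 unfolding f_def c1 c2 A_def xy xy'
      using assms by (simp add: field_simps)
  qed
  have "((\<lambda>r. A * (T r * c (N - r) * c (N + r))) has_sum
          (1 + q powi (2 * N - 1)) * S + z * q ^ n * S + q ^ Suc n / z * S) UNIV"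
    unfolding pointwise
    by (intro has_sum_add has_sum_cmult_right has_sum_shift_int f)
  also have "(1 + q powi (2 * N - 1)) * S + z * q ^ n * S + q ^ Suc n / z * S =
      A * (qpoch (- z) q (Suc n) * qpoch (- q / z) q (Suc n) * c (2 * N))"
  proof -
    have "2 * N - 1 = int (n + Suc n)"
      by (simp add: N_def)
    hence "q powi (2 * N - 1) = q ^ n * q ^ Suc n"
      by (simp only: power_int_of_nat power_add)
    thus ?thesis
      unfolding S_def c2n qpoch_Suc using assms by (simp add: field_simps)
  qed
  finally have "((\<lambda>r. T r * c (N - r) * c (N + r)) has_sum
      qpoch (- z) q (Suc n) * qpoch (- q / z) q (Suc n) * c (2 * N)) UNIV"
    using A by (simp add: has_sum_cmult_right_iff)
  thus ?case
    by (simp add: T_def c_def N_def add.commute)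
qed

text \<open>With N = M + 1, split 1 - q^N = (1 - q^k) + q^k (1 - q^(N-k)) inside the sum for N.
  After shifting the first part by one, the two parts add up termwise to the sum for M with
  \<open>m + 1\<close> in place of \<open>m\<close>, so \<open>m\<close> must vary in the
  induction.\<close>

lemma q_Vandermonde:
  assumes "q \<noteq> 0" "norm q < 1"
  shows "((\<lambda>k. q powi (k * (k + m)) * inv_qfact q (int M - k) * inv_qfact q k * inv_qfact q (k + m))
           has_sum inv_qfact q (int M) * inv_qfact q (int M + m)) UNIV"
proof (induction M arbitrary: m)
  case 0
  show ?case
    by (rule has_sum_finite_neutralI[of "{0}"]) (auto simp: inv_qfact_def)
next
  case (Suc M)
  define N where "N = int M + 1"
  define c where "c = inv_qfact q"
  have c_pred: "c (k - 1) = (1 - q powi k) * c k" for k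
    unfolding c_def by (rule inv_qfact_pred) (use assms in auto)
  define g where "g = (\<lambda>k. q powi (k * (k + m)) * c (N - k) * c k * c (k + m))"
  define f where "f = (\<lambda>k. q powi (k * (k + (m + 1))) * c (int M - k) * c k * c (k + (m + 1)))"
  define g1 where "g1 = (\<lambda>k. (1 - q powi k) * g k)"
  define g2 where "g2 = (\<lambda>k. q powi k * (1 - q powi (N - k)) * g k)"
  have f: "(f has_sum c (int M) * c (int M + (m + 1))) UNIV"
    unfolding f_def c_def by (rule Suc.IH)
  have supp: "{k \<in> UNIV. h k * g k \<noteq> 0} \<subseteq> {0..N}" for h :: "int \<Rightarrow> complex"
    by (auto simp: g_def c_def inv_qfact_def split: if_splits)
  have fin: "(\<lambda>k. h k * g k) summable_on UNIV" for h :: "int \<Rightarrow> complex"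
    by (rule finite_nonzero_values_imp_summable_on) (rule finite_subset[OF supp], simp)
  obtain S1 S2 where S1: "(g1 has_sum S1) UNIV" and S2: "(g2 has_sum S2) UNIV"
    unfolding g1_def g2_def using fin summable_iff_has_sum_infsum by metis
  have fg: "f k = g1 (k + 1) + g2 k" for k
  proof -
    have "g1 (k + 1) = q powi ((k + 1) * (k + 1 + m)) * c (N - (k + 1)) *
        ((1 - q powi (k + 1)) * c (k + 1)) * c (k + 1 + m)"
      by (simp only: g1_def g_def mult_ac)
    also have "\<dots> = q powi ((k + 1) * (k + 1 + m)) * c (int M - k) * c k * c (k + (m + 1))"
      using c_pred[of "k + 1"] by (simp add: N_def add_ac)
    also have "(k + 1) * (k + 1 + m) = k * (k + (m + 1)) + (k + m + 1)"
      by (simp add: algebra_simps)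
    finally have 1: "g1 (k + 1) = q powi (k * (k + (m + 1))) * q powi (k + m + 1) * c (int M - k) * c k * c (k + (m + 1))"
      using assms by (simp add: power_int_add)
    have "g2 k = q powi k * q powi (k * (k + m)) * ((1 - q powi (N - k)) * c (N - k)) * c k * c (k + m)"
      by (simp only: g2_def g_def mult_ac)
    also have "\<dots> = q powi k * q powi (k * (k + m)) * c (int M - k) * c k * c (k + m)"
      using c_pred[of "N - k"] by (simp add: N_def)
    also have "q powi k * q powi (k * (k + m)) = q powi (k * (k + (m + 1)))"
      using assms by (simp add: algebra_simps flip: power_int_add)
    also have "c (k + m) = (1 - q powi (k + m + 1)) * c (k + (m + 1))"
      using c_pred[of "k + m + 1"] by (simp add: algebra_simps)
    finally show ?thesis
      unfolding 1 f_def by (simp add: algebra_simps)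
  qed
  have "(f has_sum S1 + S2) UNIV"
    unfolding fg by (intro has_sum_add has_sum_shift_int S1 S2)
  hence S: "S1 + S2 = c (int M) * c (int M + (m + 1))"
    using f has_sum_unique by blast
  have "((\<lambda>k. g1 k + g2 k) has_sum S1 + S2) UNIV"
    by (intro has_sum_add S1 S2)
  also have "(\<lambda>k. g1 k + g2 k) = (\<lambda>k. (1 - q powi N) * g k)"
  proof
    fix k
    have "q powi N = q powi k * q powi (N - k)"
      using assms by (simp flip: power_int_add)
    thus "g1 k + g2 k = (1 - q powi N) * g k"
      by (simp add: g1_def g2_def algebra_simps)
  qed
  also have "S1 + S2 = (1 - q powi N) * (c N * c (N + m))"
    unfolding S using c_pred[of N] by (simp add: N_def add_ac)
  finally have "((\<lambda>k. (1 - q powi N) * g k) has_sum (1 - q powi N) * (c N * c (N + m))) UNIV" .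
  moreover have "1 - q powi N \<noteq> 0"
    using power_neq_1[OF assms(2), of "Suc M"] by (simp add: N_def power_int_def nat_add_distrib)
  ultimately have "(g has_sum c N * c (N + m)) UNIV"
    by (simp add: has_sum_cmult_right_iff)
  thus ?case
    by (simp add: g_def c_def N_def add.commute)
qed

text \<open>The preceding sum with k = s - r, m = 2 r and M = n - r, since s^2 = r^2 + (s - r) (s +
  r). For r > n both sides vanish.\<close>

lemma q_Vandermonde_centered:
  assumes "q \<noteq> 0" "norm q < 1"
  shows "(\<Sum>s\<le>n. q ^ (s ^ 2) * inv_qfact q (int n - int s) *
             (inv_qfact q (int s - r) * inv_qfact q (int s + r))) =
         q powi (r * r) * (inv_qfact q (int n - r) * inv_qfact q (int n + r))"
proof (cases "r \<le> int n")
  case False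
  have "inv_qfact q (int s - r) = 0" if "s \<le> n" for s
    using False that by auto
  thus ?thesis using False by simp
next
  case True
  define M where "M = nat (int n - r)"
  have M: "int M = int n - r"
    using True by (simp add: M_def)
  define h where "h = (\<lambda>s. q powi (s * s) * inv_qfact q (int n - s) *
                   (inv_qfact q (s - r) * inv_qfact q (s + r)))"
  have "((\<lambda>k. q powi (k * (k + 2 * r)) * inv_qfact q (int M - k) * inv_qfact q k * inv_qfact q (k + 2 * r))
           has_sum inv_qfact q (int M) * inv_qfact q (int M + 2 * r)) UNIV"
    by (rule q_Vandermonde[OF assms])
  from has_sum_cmult_right[OF has_sum_shift_int[OF this, of "- r"], of "q powi (r * r)"]
  have "((\<lambda>s. q powi (r * r) * (q powi ((s - r) * (s + r)) * inv_qfact q (int n - s) *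
            inv_qfact q (s - r) * inv_qfact q (s + r)))
          has_sum q powi (r * r) * (inv_qfact q (int n - r) * inv_qfact q (int n + r))) UNIV"
    unfolding M by (simp add: algebra_simps)
  also have "(\<lambda>s. q powi (r * r) * (q powi ((s - r) * (s + r)) * inv_qfact q (int n - s) *
            inv_qfact q (s - r) * inv_qfact q (s + r))) = h"
  proof
    fix s
    have "q powi (s * s) = q powi (r * r) * q powi ((s - r) * (s + r))"
      using assms by (simp add: algebra_simps flip: power_int_add)
    thus "q powi (r * r) * (q powi ((s - r) * (s + r)) * inv_qfact q (int n - s) *
            inv_qfact q (s - r) * inv_qfact q (s + r)) = h s"
      by (simp add: h_def)
  qed
  finally have "infsum h UNIV = q powi (r * r) * (inv_qfact q (int n - r) * inv_qfact q (int n + r))"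
    by (rule infsumI)
  moreover have "infsum h UNIV = infsum h {0..int n}"
  proof (rule infsum_cong_neutral)
    fix s assume "s \<in> UNIV - {0..int n}"
    \<comment> \<open>If s < 0, one of s - r and s + r is negative because they add up to 2
      s.\<close>
    hence "int n - s < 0 \<or> s - r < 0 \<or> s + r < 0" by auto
    thus "h s = 0" by (auto simp: h_def)
  qed auto
  moreover have "infsum h {0..int n} = (\<Sum>s\<le>n. h (int s))"
    unfolding infsum_finite[OF finite_atLeastAtMost_int]
    by (rule sum.reindex_bij_witness[of _ int nat]) auto
  ultimately show ?thesis
    by (simp add: h_def power2_eq_square flip: power_int_of_nat)
qed

text \<open>A Bailey pair relative to a = 1 in bilateral form: the weight is even in r, so the
  classical sequence is obtained by adding the entries at r and -r.\<close>

definition bailey_pair :: "complex \<Rightarrow> (int \<Rightarrow> complex) \<Rightarrow> (nat \<Rightarrow> complex) \<Rightarrow> bool" where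
  "bailey_pair q \<alpha> \<beta> \<longleftrightarrow>
     (\<forall>n. ((\<lambda>r. \<alpha> r * (inv_qfact q (int n - r) * inv_qfact q (int n + r))) has_sum \<beta> n) UNIV)"

text \<open>Bailey's lemma with both free parameters sent to infinity. Exchanging the two sums
  leaves an inner sum over s, which is \<open>q_Vandermonde_centered\<close>.\<close>

lemma bailey_step:
  assumes "q \<noteq> 0" "norm q < 1" "bailey_pair q \<alpha> \<beta>"
  shows "bailey_pair q (\<lambda>r. q powi (r * r) * \<alpha> r)
           (\<lambda>n. \<Sum>s\<le>n. q ^ (s ^ 2) * \<beta> s * inv_qfact q (int n - int s))"
  unfolding bailey_pair_def
proof
  fix n
  define c where "c = inv_qfact q"
  have "((\<lambda>r. \<Sum>s\<le>n. (q ^ (s ^ 2) * c (int n - int s)) * (\<alpha> r * (c (int s - r) * c (int s + r)))) has_sum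
          (\<Sum>s\<le>n. (q ^ (s ^ 2) * c (int n - int s)) * \<beta> s)) UNIV"
    using assms(3) unfolding bailey_pair_def c_def by (intro has_sum_sum has_sum_cmult_right) auto
  also have "(\<lambda>r. \<Sum>s\<le>n. (q ^ (s ^ 2) * c (int n - int s)) * (\<alpha> r * (c (int s - r) * c (int s + r)))) =
      (\<lambda>r. \<alpha> r * (\<Sum>s\<le>n. q ^ (s ^ 2) * c (int n - int s) * (c (int s - r) * c (int s + r))))"
    by (simp add: sum_distrib_left mult_ac)
  finally show "((\<lambda>r. q powi (r * r) * \<alpha> r * (inv_qfact q (int n - r) * inv_qfact q (int n + r))) has_sum
      (\<Sum>s\<le>n. q ^ (s ^ 2) * \<beta> s * inv_qfact q (int n - int s))) UNIV"
    unfolding c_def q_Vandermonde_centered[OF assms(1,2)] by (simp add: mult_ac)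
qed

lemma bailey_pair_theta:
  assumes "q \<noteq> 0" "norm q < 1" "z \<noteq> 0"
  shows "bailey_pair q (theta_term q z)
           (\<lambda>n. qpoch (- z) q n * qpoch (- q / z) q n * inv_qfact q (2 * int n))"
  unfolding bailey_pair_def using finite_triple_product[OF assms] by (simp add: mult.assoc)

text \<open>For fixed r each of the two reciprocals tends to 1/(q;q)_\<infinity>, and both are
  bounded by a common K, so K^2 |\<alpha> r| is a majorant.\<close>

lemma bailey_pair_limit:
  assumes "norm q < 1" "bailey_pair q \<alpha> \<beta>" "(\<lambda>r. norm (\<alpha> r)) summable_on UNIV"
  shows "\<beta> \<longlonglongrightarrow> infsum \<alpha> UNIV / qpoch_inf q q ^ 2"
proof -
  obtain K where K: "K > 0" "\<And>k. norm (inv_qfact q k) \<le> K"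
    using inv_qfact_bounded[OF assms(1)] by blast
  have "(\<lambda>n. infsum (\<lambda>r. \<alpha> r * (inv_qfact q (int n - r) * inv_qfact q (int n + r))) UNIV) \<longlonglongrightarrow>
          infsum (\<lambda>r. \<alpha> r * (1 / qpoch_inf q q * (1 / qpoch_inf q q))) UNIV"
  proof (rule infsum_dominated_convergence)
    fix r
    show "(\<lambda>n. \<alpha> r * (inv_qfact q (int n - r) * inv_qfact q (int n + r))) \<longlonglongrightarrow>
            \<alpha> r * (1 / qpoch_inf q q * (1 / qpoch_inf q q))"
      using inv_qfact_shift_tendsto[OF assms(1), of "- r"] inv_qfact_shift_tendsto[OF assms(1), of r]
      by (intro tendsto_mult tendsto_const) auto
    fix n :: nat
    show "norm (\<alpha> r * (inv_qfact q (int n - r) * inv_qfact q (int n + r))) \<le> norm (\<alpha> r) * (K * K)"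
      unfolding norm_mult using K by (intro mult_left_mono mult_mono) auto
  next
    show "(\<lambda>r. norm (\<alpha> r) * (K * K)) summable_on UNIV"
      by (intro summable_on_cmult_left assms)
  qed
  moreover have "infsum (\<lambda>r. \<alpha> r * (inv_qfact q (int n - r) * inv_qfact q (int n + r))) UNIV = \<beta> n" for n
    using assms(2) by (auto simp: bailey_pair_def intro: infsumI)
  ultimately show ?thesis
    unfolding infsum_cmult_left' by (simp add: power2_eq_square)
qed

text \<open>The limit of the finite form, evaluated once from the sum and once from the
  product.\<close>

theorem Jacobi_triple_product:
  assumes "q \<noteq> 0" "norm q < 1" "z \<noteq> 0"
  shows "theta q z = qpoch_inf (- z) q * qpoch_inf (- q / z) q * qpoch_inf q q"
proof -
  let ?\<beta> = "\<lambda>n. qpoch (- z) q n * qpoch (- q / z) q n * inv_qfact q (2 * int n)"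
  have "?\<beta> \<longlonglongrightarrow> theta q z / qpoch_inf q q ^ 2"
    unfolding theta_def
    by (intro bailey_pair_limit bailey_pair_theta abs_summable_theta_term assms)
  moreover have "?\<beta> \<longlonglongrightarrow> qpoch_inf (- z) q * qpoch_inf (- q / z) q * (1 / qpoch_inf q q)"
  proof (intro tendsto_mult qpoch_tendsto assms)
    have "filterlim (\<lambda>n. 2 * n) sequentially sequentially"
      by (rule filterlim_subseq) (auto simp: strict_mono_def)
    from filterlim_compose[OF inv_qfact_tendsto[OF assms(2)] this]
    show "(\<lambda>n. inv_qfact q (2 * int n)) \<longlonglongrightarrow> 1 / qpoch_inf q q" by simp
  qed
  ultimately have "theta q z / qpoch_inf q q ^ 2 =
      qpoch_inf (- z) q * qpoch_inf (- q / z) q * (1 / qpoch_inf q q)"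
    by (rule LIMSEQ_unique)
  thus ?thesis
    using qpoch_inf_self_nonzero[OF assms(2)] by (simp add: field_simps power2_eq_square)
qed

text \<open>Evaluates the \<beta> side of a Bailey step as n grows. Terms with s > n vanish, so the
  finite sums are sums over all s and dominated convergence applies.\<close>

lemma qfact_convolution_limit:
  fixes \<gamma> :: "nat \<Rightarrow> complex"
  assumes "norm q < 1" "summable (\<lambda>s. norm (\<gamma> s))"
  shows "(\<lambda>n. \<Sum>s\<le>n. \<gamma> s * inv_qfact q (int n - int s)) \<longlonglongrightarrow> suminf \<gamma> / qpoch_inf q q"
proof -
  obtain K where K: "K > 0" "\<And>k. norm (inv_qfact q k) \<le> K"
    using inv_qfact_bounded[OF assms(1)] by blast
  have sm: "(\<lambda>s. norm (\<gamma> s)) summable_on UNIV"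
    using assms(2) by (subst summable_on_UNIV_nonneg_real_iff) auto
  have "(\<lambda>n. infsum (\<lambda>s. \<gamma> s * inv_qfact q (int n - int s)) UNIV) \<longlonglongrightarrow>
          infsum (\<lambda>s. \<gamma> s * (1 / qpoch_inf q q)) UNIV"
  proof (rule infsum_dominated_convergence)
    fix s
    show "(\<lambda>n. \<gamma> s * inv_qfact q (int n - int s)) \<longlonglongrightarrow> \<gamma> s * (1 / qpoch_inf q q)"
      using inv_qfact_shift_tendsto[OF assms(1), of "- int s"] by (intro tendsto_mult tendsto_const) auto
    fix n :: nat
    show "norm (\<gamma> s * inv_qfact q (int n - int s)) \<le> norm (\<gamma> s) * K"
      unfolding norm_mult using K by (intro mult_left_mono) auto
  next
    show "(\<lambda>s. norm (\<gamma> s) * K) summable_on UNIV"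
      by (intro summable_on_cmult_left sm)
  qed
  moreover have "infsum (\<lambda>s. \<gamma> s * inv_qfact q (int n - int s)) UNIV =
      (\<Sum>s\<le>n. \<gamma> s * inv_qfact q (int n - int s))" for n
    by (rule infsumI, rule has_sum_finite_neutralI) (auto simp: not_le)
  moreover have "infsum (\<lambda>s. \<gamma> s * (1 / qpoch_inf q q)) UNIV = suminf \<gamma> / qpoch_inf q q"
    unfolding infsum_cmult_left'
    using norm_summable_imp_has_sum[OF assms(2) summable_sums[OF summable_norm_cancel[OF assms(2)]]]
    by (simp add: infsumI)
  ultimately show ?thesis by simp
qed

section \<open>The Rogers--Ramanujan identities\<close>

lemma qpoch_eq_0:
  assumes "k < n" "a * q ^ k = 1"
  shows "qpoch a q n = 0"
  unfolding qpoch_def using assms by (intro prod_zero) (auto intro!: bexI[of _ k])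

text \<open>The origin of the modulus 5: two Bailey steps contribute q^(2 r^2), and 2 r^2 = 4 tri r
  + 2 r turns the exponent tri r into 5 tri r + 2 r.\<close>

lemma theta_term_bailey:
  assumes "q \<noteq> 0"
  shows "q powi (r * r) * (q powi (r * r) * theta_term q z r) = theta_term (q ^ 5) (q ^ 2 * z) r"
proof -
  have "5 * tri r + 2 * r = r * r + (r * r + tri r)"
    using two_tri[of r] by (simp add: algebra_simps)
  moreover have "q powi (5 * tri r + 2 * r) = (q ^ 5) powi tri r * (q ^ 2) powi r"
    using assms by (simp add: power_int_add power_int_mult)
  moreover have "q powi (r * r + (r * r + tri r)) = q powi (r * r) * (q powi (r * r) * q powi tri r)"
    by (simp only: power_int_add[OF disjI1[OF assms]])
  ultimately have "q powi (r * r) * (q powi (r * r) * q powi tri r) = (q ^ 5) powi tri r * (q ^ 2) powi r"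
    by metis
  thus ?thesis
    by (simp only: theta_term_def power_int_mult_distrib mult.assoc[symmetric])
qed

text \<open>Here \<beta> is the sequence after one Bailey step; the second step is followed by n to
  infinity on both sides. Boundedness of \<beta> suffices because q^(s^2) forces
  convergence.\<close>

lemma rogers_ramanujan_limit:
  assumes "q \<noteq> 0" "norm q < 1" "z \<noteq> 0"
    and \<beta>: "bailey_pair q (\<lambda>r. q powi (r * r) * theta_term q z r) \<beta>"
    and b: "\<And>n. norm (\<beta> n) \<le> K"
  shows "qpoch_inf q q * (\<Sum>s. q ^ (s ^ 2) * \<beta> s) = theta (q ^ 5) (q ^ 2 * z)"
proof -
  let ?E = "qpoch_inf q q"
  define \<beta>' where "\<beta>' = (\<lambda>n. \<Sum>s\<le>n. q ^ (s ^ 2) * \<beta> s * inv_qfact q (int n - int s))"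
  have "bailey_pair q (theta_term (q ^ 5) (q ^ 2 * z)) \<beta>'"
    using bailey_step[OF assms(1,2) \<beta>]
    unfolding theta_term_bailey[OF assms(1)] \<beta>'_def .
  moreover have "norm (q ^ 5) < 1"
    using assms(2) by (simp add: norm_power power_less_one_iff)
  ultimately have "\<beta>' \<longlonglongrightarrow> theta (q ^ 5) (q ^ 2 * z) / ?E ^ 2"
    unfolding theta_def
    by (intro bailey_pair_limit abs_summable_theta_term) (use assms in auto)
  moreover have "summable (\<lambda>s. norm (q ^ (s ^ 2) * \<beta> s))"
  proof (rule summable_comparison_test)
    show "summable (\<lambda>s. norm q ^ s * K)"
      using assms(2) by (intro summable_mult2 summable_geometric) auto
    have "norm q ^ (s ^ 2) \<le> norm q ^ s" for s
      using assms(2) by (intro power_decreasing) (auto simp: power2_eq_square)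
    hence "norm (norm (q ^ (s ^ 2) * \<beta> s)) \<le> norm q ^ s * K" for s
      using b[of s] by (auto simp: norm_mult norm_power intro!: mult_mono)
    thus "\<exists>N. \<forall>s\<ge>N. norm (norm (q ^ (s ^ 2) * \<beta> s)) \<le> norm q ^ s * K" by blast
  qed
  hence "\<beta>' \<longlonglongrightarrow> (\<Sum>s. q ^ (s ^ 2) * \<beta> s) / ?E"
    unfolding \<beta>'_def by (rule qfact_convolution_limit[OF assms(2)])
  ultimately have "theta (q ^ 5) (q ^ 2 * z) / ?E ^ 2 = (\<Sum>s. q ^ (s ^ 2) * \<beta> s) / ?E"
    by (rule LIMSEQ_unique)
  thus ?thesis
    using qpoch_inf_self_nonzero[OF assms(2)] by (simp add: field_simps power2_eq_square)
qed

text \<open>At z = -1 the factor (1;q)_n vanishes for n > 0, so the chain starts from the unit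
  Bailey pair. One step gives \<beta> n = 1/(q;q)_n, and the limit of the next step is the series of
  G.\<close>

theorem RR_G_theta:
  assumes "q \<noteq> 0" "norm q < 1"
  shows "qpoch_inf q q * RR_G q = theta (q ^ 5) (- (q ^ 2))"
proof -
  obtain K where K: "\<And>k. norm (inv_qfact q k) \<le> K"
    using inv_qfact_bounded[OF assms(2)] by blast
  have "qpoch 1 q n = 0" if "n > 0" for n
    using that by (intro qpoch_eq_0[of 0]) auto
  hence *: "qpoch (- (- 1)) q n * qpoch (- q / (- 1)) q n * inv_qfact q (2 * int n) =
             (if n = 0 then 1 else 0)" for n
    by auto
  have "bailey_pair q (\<lambda>r. q powi (r * r) * theta_term q (- 1) r)
          (\<lambda>n. \<Sum>s\<le>n. q ^ (s ^ 2) * (if s = 0 then 1 else 0) * inv_qfact q (int n - int s))"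
    using bailey_step[OF assms bailey_pair_theta[OF assms, of "-1"]] unfolding * by simp
  also have "(\<lambda>n. \<Sum>s\<le>n. q ^ (s ^ 2) * (if s = 0 then 1 else 0) * inv_qfact q (int n - int s)) =
               (\<lambda>n. inv_qfact q (int n))"
    by (simp add: if_distrib if_distribR cong: if_cong)
  finally have "qpoch_inf q q * (\<Sum>s. q ^ (s ^ 2) * inv_qfact q (int s)) = theta (q ^ 5) (q ^ 2 * - 1)"
    using K by (intro rogers_ramanujan_limit assms) auto
  thus ?thesis
    by (simp add: RR_G_def inv_qfact_int)
qed

text \<open>
  Starting the chain at \<open>z = - q\<^sup>2\<close> rather than \<open>z = - 1\<close> leaves just two nonzero terms \<open>1\<close> and
  \<open>- 1 / q\<close>, and their telescoping produces the additional factor \<open>q ^ n\<close> of the second identity.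
\<close>

theorem RR_H_theta:
  assumes "q \<noteq> 0" "norm q < 1"
  shows "qpoch_inf q q * RR_H q = theta (q ^ 5) (- q)"
proof -
  obtain K where K: "\<And>k. norm (inv_qfact q k) \<le> K"
    using inv_qfact_bounded[OF assms(2)] by blast
  define \<beta> where "\<beta> = (\<lambda>n. qpoch (- (- (q ^ 2))) q n * qpoch (- q / (- (q ^ 2))) q n * inv_qfact q (2 * int n))"
  have q2: "- q / (- (q ^ 2)) = 1 / q"
    using assms by (simp add: power2_eq_square)
  have "qpoch (1 / q) q n = 0" if "n > 1" for n
    using that assms by (intro qpoch_eq_0[of 1]) auto
  hence \<beta>_ge2: "\<beta> n = 0" if "n > 1" for n
    using that unfolding \<beta>_def q2 by simp
  have \<beta>_0: "\<beta> 0 = 1"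
    by (simp add: \<beta>_def)
  have ne: "1 - q \<noteq> 0" "1 - q ^ 2 \<noteq> 0"
    using power_neq_1[OF assms(2), of 1] power_neq_1[OF assms(2), of 2] by auto
  have "inv_qfact q 2 = 1 / ((1 - q) * (1 - q ^ 2))"
    by (simp add: inv_qfact_def qpoch_def numeral_2_eq_2)
  hence "\<beta> 1 = (1 - q ^ 2) * (1 - 1 / q) * (1 / ((1 - q) * (1 - q ^ 2)))"
    unfolding \<beta>_def q2 by (simp add: qpoch_def)
  also have "\<dots> = (1 - 1 / q) / (1 - q)"
    using ne by simp
  also have "\<dots> = - 1 / q"
    using ne(1) assms by (simp add: divide_simps)
  finally have \<beta>_1: "\<beta> 1 = - 1 / q" .
  have "bailey_pair q (\<lambda>r. q powi (r * r) * theta_term q (- (q ^ 2)) r)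
          (\<lambda>n. \<Sum>s\<le>n. q ^ (s ^ 2) * \<beta> s * inv_qfact q (int n - int s))"
    unfolding \<beta>_def by (intro bailey_step bailey_pair_theta) (use assms in auto)
  also have "(\<lambda>n. \<Sum>s\<le>n. q ^ (s ^ 2) * \<beta> s * inv_qfact q (int n - int s)) =
               (\<lambda>n. q ^ n * inv_qfact q (int n))"
  proof
    fix n
    show "(\<Sum>s\<le>n. q ^ (s ^ 2) * \<beta> s * inv_qfact q (int n - int s)) = q ^ n * inv_qfact q (int n)"
    proof (cases n)
      case 0
      thus ?thesis by (simp add: \<beta>_0)
    next
      case (Suc m)
      have "(\<Sum>s\<le>n. q ^ (s ^ 2) * \<beta> s * inv_qfact q (int n - int s)) =
            (\<Sum>s\<in>{0, 1}. q ^ (s ^ 2) * \<beta> s * inv_qfact q (int n - int s))"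
        using Suc \<beta>_ge2 by (intro sum.mono_neutral_right) auto
      also have "\<dots> = inv_qfact q (int n) - inv_qfact q (int n - 1)"
        using assms \<beta>_1 by (simp add: \<beta>_0)
      also have "\<dots> = q ^ n * inv_qfact q (int n)"
        unfolding inv_qfact_pred[OF assms(2)] by (simp add: algebra_simps)
      finally show ?thesis .
    qed
  qed
  finally have "qpoch_inf q q * (\<Sum>s. q ^ (s ^ 2) * (q ^ s * inv_qfact q (int s))) =
      theta (q ^ 5) (q ^ 2 * - (q ^ 2))"
  proof (intro rogers_ramanujan_limit assms)
    fix n
    have "norm q ^ n * norm (inv_qfact q (int n)) \<le> 1 * K"
      using K[of "int n"] assms by (intro mult_mono power_le_one) auto
    thus "norm (q ^ n * inv_qfact q (int n)) \<le> K"
      by (simp add: norm_mult norm_power)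
  qed (use assms in auto)
  also have "theta (q ^ 5) (q ^ 2 * - (q ^ 2)) = theta (q ^ 5) (q ^ 5 / (q ^ 2 * - (q ^ 2)))"
    using assms by (intro theta_reflect[symmetric]) auto
  also have "q ^ 5 / (q ^ 2 * - (q ^ 2)) = - q"
    using assms by (simp add: field_simps eval_nat_numeral)
  finally show ?thesis
    by (simp add: RR_H_def inv_qfact_int power_add power2_eq_square mult_ac)
qed

section \<open>Infinite products split by residue, and the product G H\<close>

lemma qpoch_inf_dissect:
  assumes "norm q < 1" "m > 0"
  shows "qpoch_inf a q = (\<Prod>j<m. qpoch_inf (a * q ^ j) (q ^ m))"
proof -
  have qm: "norm (q ^ m) < 1"
    using assms by (simp add: norm_power power_less_one_iff)
  have "qpoch a q (n * m) = (\<Prod>j<m. qpoch (a * q ^ j) (q ^ m) n)" for n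
  proof -
    have "prod g {k * m..<k * m + m} = (\<Prod>j<m. g (k * m + j))" for g :: "nat \<Rightarrow> complex" and k
      by (simp add: prod.atLeastLessThan_shift_0[of g "k * m"] atLeast0LessThan)
    hence "qpoch a q (n * m) = (\<Prod>k<n. \<Prod>j<m. 1 - a * q ^ (k * m + j))"
      unfolding qpoch_def prod.nat_group[symmetric] by simp
    also have "\<dots> = (\<Prod>j<m. \<Prod>k<n. 1 - a * q ^ (k * m + j))"
      by (rule prod.swap)
    finally show ?thesis
      by (simp add: qpoch_def power_add mult_ac flip: power_mult)
  qed
  moreover have "(\<lambda>n. \<Prod>j<m. qpoch (a * q ^ j) (q ^ m) n) \<longlonglongrightarrow> (\<Prod>j<m. qpoch_inf (a * q ^ j) (q ^ m))"
    by (intro tendsto_prod qpoch_tendsto qm)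
  \<comment> \<open>Working with partial products of length n m and passing to a subsequence avoids
    rearranging an infinite product.\<close>
  moreover have "filterlim (\<lambda>n. n * m) sequentially sequentially"
    using assms by (intro filterlim_subseq) (auto simp: strict_mono_def)
  hence "(\<lambda>n. qpoch a q (n * m)) \<longlonglongrightarrow> qpoch_inf a q"
    by (rule filterlim_compose[OF qpoch_tendsto[OF assms(1)]])
  ultimately show ?thesis
    using LIMSEQ_unique by fastforce
qed

lemma theta_power5:
  assumes "q \<noteq> 0" "norm q < 1"
  shows "theta (q ^ 5) (- q) = qpoch_inf q (q ^ 5) * qpoch_inf (q ^ 4) (q ^ 5) * qpoch_inf (q ^ 5) (q ^ 5)"
    and "theta (q ^ 5) (- (q ^ 2)) = qpoch_inf (q ^ 2) (q ^ 5) * qpoch_inf (q ^ 3) (q ^ 5) * qpoch_inf (q ^ 5) (q ^ 5)"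
proof -
  have "norm (q ^ 5) < 1"
    using assms(2) by (simp add: norm_power power_less_one_iff)
  moreover have "- (q ^ 5) / - q = q ^ 4" "- (q ^ 5) / - (q ^ 2) = q ^ 3"
    using assms by (simp_all add: field_simps eval_nat_numeral)
  ultimately show "theta (q ^ 5) (- q) = qpoch_inf q (q ^ 5) * qpoch_inf (q ^ 4) (q ^ 5) * qpoch_inf (q ^ 5) (q ^ 5)"
    "theta (q ^ 5) (- (q ^ 2)) = qpoch_inf (q ^ 2) (q ^ 5) * qpoch_inf (q ^ 3) (q ^ 5) * qpoch_inf (q ^ 5) (q ^ 5)"
    using Jacobi_triple_product[of "q ^ 5" "- q"] Jacobi_triple_product[of "q ^ 5" "- (q ^ 2)"] assms
    by simp_all
qed

text \<open>The two triple products cover the residues 1, 4 and 2, 3 modulo 5, and each also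
  contains residue 0. One copy of the latter completes E(q); the other is left over.\<close>

lemma theta_power5_mult:
  assumes "q \<noteq> 0" "norm q < 1"
  shows "theta (q ^ 5) (- q) * theta (q ^ 5) (- (q ^ 2)) = qpoch_inf q q * qpoch_inf (q ^ 5) (q ^ 5)"
proof -
  have "qpoch_inf q q = (\<Prod>j<5. qpoch_inf (q * q ^ j) (q ^ 5))"
    by (rule qpoch_inf_dissect) (use assms in auto)
  also have "\<dots> = qpoch_inf q (q ^ 5) * qpoch_inf (q ^ 2) (q ^ 5) * qpoch_inf (q ^ 3) (q ^ 5) *
      qpoch_inf (q ^ 4) (q ^ 5) * qpoch_inf (q ^ 5) (q ^ 5)"
    by (simp add: eval_nat_numeral)
  finally show ?thesis
    unfolding theta_power5[OF assms] by (simp add: mult_ac)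
qed

lemma RR_G_RR_H:
  assumes "q \<noteq> 0" "norm q < 1"
  shows "qpoch_inf (q ^ 5) (q ^ 5) = qpoch_inf q q * RR_G q * RR_H q"
proof -
  have "qpoch_inf q q * qpoch_inf (q ^ 5) (q ^ 5) = (qpoch_inf q q * RR_H q) * (qpoch_inf q q * RR_G q)"
    unfolding RR_G_theta[OF assms] RR_H_theta[OF assms] theta_power5_mult[OF assms] ..
  thus ?thesis
    using qpoch_inf_self_nonzero[OF assms(2)] by (simp add: mult_ac)
qed

section \<open>The quintuple product identity\<close>

lemma abs_summable_times:
  fixes f :: "'a \<Rightarrow> complex" and g :: "'b \<Rightarrow> complex"
  assumes "(\<lambda>x. norm (f x)) summable_on A" "(\<lambda>y. norm (g y)) summable_on B"
  shows "(\<lambda>(x, y). norm (f x * g y)) summable_on A \<times> B"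
proof (rule summable_on_SigmaI)
  fix x
  show "((\<lambda>y. (\<lambda>(x, y). norm (f x * g y)) (x, y)) has_sum
          norm (f x) * infsum (\<lambda>y. norm (g y)) B) B"
    using has_sum_cmult_right[OF has_sum_infsum[OF assms(2)], of "norm (f x)"] by (simp add: norm_mult)
next
  show "(\<lambda>x. norm (f x) * infsum (\<lambda>y. norm (g y)) B) summable_on A"
    by (rule summable_on_cmult_left[OF assms(1)])
qed auto

lemma has_sum_times:
  fixes f :: "'a \<Rightarrow> complex" and g :: "'b \<Rightarrow> complex"
  assumes "(\<lambda>x. norm (f x)) summable_on A" "(\<lambda>y. norm (g y)) summable_on B"
    and "(f has_sum S) A" "(g has_sum T) B"
  shows "((\<lambda>(x, y). f x * g y) has_sum S * T) (A \<times> B)"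
proof (rule has_sum_SigmaI)
  fix x
  show "((\<lambda>y. (\<lambda>(x, y). f x * g y) (x, y)) has_sum f x * T) B"
    using has_sum_cmult_right[OF assms(4)] by simp
next
  show "((\<lambda>x. f x * T) has_sum S * T) A"
    by (rule has_sum_cmult_left[OF assms(3)])
next
  show "(\<lambda>(x, y). f x * g y) summable_on A \<times> B"
    using abs_summable_times[OF assms(1,2)]
    by (rule abs_summable_summable[OF back_subst[of "\<lambda>h. h summable_on A \<times> B"]]) auto
qed

lemma has_sum_theta_times:
  assumes "p \<noteq> 0" "norm p < 1" "z \<noteq> 0" "p' \<noteq> 0" "norm p' < 1" "z' \<noteq> 0"
  shows "((\<lambda>(m, n). theta_term p z m * theta_term p' z' n) has_sum theta p z * theta p' z') UNIV"
proof -
  have "((\<lambda>(m, n). theta_term p z m * theta_term p' z' n) has_sum theta p z * theta p' z') (UNIV \<times> UNIV)"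
    by (intro has_sum_times abs_summable_theta_term has_sum_theta assms)
  thus ?thesis by simp
qed

lemma infsum_parity_split:
  fixes F :: "int \<times> int \<Rightarrow> complex"
  assumes "F summable_on UNIV"
  shows "infsum F UNIV = infsum F {(m, n). even (m + n)} + infsum F {(m, n). odd (m + n)}"
proof -
  have "F summable_on X" for X
    using summable_on_subset_banach[OF assms subset_UNIV] .
  hence "infsum F ({(m, n). even (m + n)} \<union> {(m, n). odd (m + n)}) =
      infsum F {(m, n). even (m + n)} + infsum F {(m, n). odd (m + n)}"
    by (intro infsum_Un_disjoint) auto
  moreover have "{(m, n). even (m + n :: int)} \<union> {(m, n). odd (m + n)} = UNIV"
    by auto
  ultimately show ?thesis by simp
qed

text \<open>
  After completing squares both sides are sums over \<open>x\<^sup>2 + 3y\<^sup>2\<close>. Multiplication by a sixth root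
  of unity matches the right-hand side with half of the terms on the left; the other
  half of the left-hand side cancels in pairs under another such rotation.
\<close>

theorem quintuple_product:
  assumes "p \<noteq> 0" "norm p < 1" "w \<noteq> 0"
  shows "theta p w * (theta (p ^ 3) (p ^ 2 / w ^ 3) - w * theta (p ^ 3) (p ^ 2 * w ^ 3)) =
         theta p (- (w ^ 2)) * theta (p ^ 3) (- p)"
proof -
  define A where "A = (\<lambda>(n, m). theta_term p w n * theta_term (p ^ 3) (p ^ 2 / w ^ 3) m)"
  define B where "B = (\<lambda>(n, m). w * (theta_term p w n * theta_term (p ^ 3) (p ^ 2 * w ^ 3) m))"
  define R where "R = (\<lambda>(a, b). theta_term p (- (w ^ 2)) a * theta_term (p ^ 3) (- p) b)"
  let ?Ev = "{(m :: int, n :: int). even (m + n)}"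
  let ?Od = "{(m :: int, n :: int). odd (m + n)}"
  have p3: "norm (p ^ 3) < 1"
    using assms by (simp add: norm_power power_less_one_iff)
  have A: "(A has_sum theta p w * theta (p ^ 3) (p ^ 2 / w ^ 3)) UNIV"
    unfolding A_def using assms p3 by (intro has_sum_theta_times) auto
  have R: "(R has_sum theta p (- (w ^ 2)) * theta (p ^ 3) (- p)) UNIV"
    unfolding R_def using assms p3 by (intro has_sum_theta_times) auto
  have B: "(B has_sum w * (theta p w * theta (p ^ 3) (p ^ 2 * w ^ 3))) UNIV"
    using has_sum_cmult_right[OF has_sum_theta_times[of p w "p ^ 3" "p ^ 2 * w ^ 3"], of w] assms p3
    unfolding B_def by (simp add: case_prod_unfold)
  have A_eq: "A (n, m) = p powi (tri n + 3 * tri m + 2 * m) * w powi (n - 3 * m)" for n m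
    using assms
    by (simp add: A_def theta_term_def power_int_add power_int_diff power_int_mult
          power_int_divide_distrib)
  have B_eq: "B (n, m) = p powi (tri n + 3 * tri m + 2 * m) * w powi (n + 3 * m + 1)" for n m
    using assms
    by (simp add: B_def theta_term_def power_int_add power_int_mult power_int_mult_distrib)
  have R_eq: "R (a, b) = (if even (a + b) then 1 else - 1) *
      (p powi (tri a + 3 * tri b + b) * w powi (2 * a))" for a b
    using assms
    by (auto simp: R_def theta_term_def power_int_add power_int_mult power_int_minus_left)
  have AR: "A (2 * b - m, m) = R (b - 2 * m, b)" for b m
  proof -
    have "tri (2 * b - m) + 3 * tri m + 2 * m = tri (b - 2 * m) + 3 * tri b + b"
      using two_tri[of "2 * b - m"] two_tri[of m] two_tri[of "b - 2 * m"] two_tri[of b]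
      by (simp add: algebra_simps)
    thus ?thesis
      unfolding A_eq R_eq by simp
  qed
  have BR: "B (m + 1 - 2 * b, m) = - R (2 * m + 1 - b, b)" for b m
  proof -
    have e1: "tri (m + 1 - 2 * b) + 3 * tri m + 2 * m = tri (2 * m + 1 - b) + 3 * tri b + b"
      using two_tri[of "m + 1 - 2 * b"] two_tri[of m] two_tri[of "2 * m + 1 - b"] two_tri[of b]
      by (simp add: algebra_simps)
    have e2: "m + 1 - 2 * b + 3 * m + 1 = 2 * (2 * m + 1 - b)"
      by simp
    show ?thesis
      unfolding B_eq R_eq e1 e2 by simp
  qed
  have AB: "A (1 + 2 * m + k, k) = B (- 2 * k - m, m)" for k m
  proof -
    have "tri (1 + 2 * m + k) + 3 * tri k + 2 * k = tri (- 2 * k - m) + 3 * tri m + 2 * m"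
      using two_tri[of "1 + 2 * m + k"] two_tri[of k] two_tri[of "- 2 * k - m"] two_tri[of m]
      by (simp add: algebra_simps)
    thus ?thesis
      unfolding A_eq B_eq by (simp add: algebra_simps)
  qed
  have "infsum A ?Ev = infsum (\<lambda>(b, m). A (2 * b - m, m)) UNIV"
    by (rule infsum_reindex_bij_witness[of _ "\<lambda>(b, m). (2 * b - m, m)" "\<lambda>(n, m). ((n + m) div 2, m)"]) auto
  also have "\<dots> = infsum (\<lambda>(b, m). R (b - 2 * m, b)) UNIV"
    by (simp only: AR)
  also have "\<dots> = infsum R ?Ev"
    by (rule infsum_reindex_bij_witness[of _ "\<lambda>(a, b). (b, (b - a) div 2)" "\<lambda>(b, m). (b - 2 * m, b)"]) auto
  finally have 1: "infsum A ?Ev = infsum R ?Ev" .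
  have "infsum B ?Od = infsum (\<lambda>(b, m). B (m + 1 - 2 * b, m)) UNIV"
    by (rule infsum_reindex_bij_witness[of _ "\<lambda>(b, m). (m + 1 - 2 * b, m)" "\<lambda>(n, m). ((m + 1 - n) div 2, m)"])
       (auto elim!: oddE simp: add.commute)
  also have "\<dots> = infsum (\<lambda>(b, m). - R (2 * m + 1 - b, b)) UNIV"
    by (simp only: BR)
  also have "\<dots> = infsum (\<lambda>x. - R x) ?Od"
    by (rule infsum_reindex_bij_witness[of _ "\<lambda>(a, b). (b, (a + b - 1) div 2)" "\<lambda>(b, m). (2 * m + 1 - b, b)"]) auto
  finally have 2: "infsum B ?Od = - infsum R ?Od"
    by (simp add: infsum_uminus)
  have "infsum A ?Od = infsum (\<lambda>(k, m). A (1 + 2 * m + k, k)) UNIV"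
    by (rule infsum_reindex_bij_witness[of _ "\<lambda>(k, m). (1 + 2 * m + k, k)" "\<lambda>(n, k). (k, (n - 1 - k) div 2)"]) auto
  also have "\<dots> = infsum (\<lambda>(k, m). B (- 2 * k - m, m)) UNIV"
    by (simp only: AB)
  also have "\<dots> = infsum B ?Ev"
    by (rule infsum_reindex_bij_witness[of _ "\<lambda>(n, m). ((- n - m) div 2, m)" "\<lambda>(k, m). (- 2 * k - m, m)"]) auto
  finally have 3: "infsum A ?Od = infsum B ?Ev" .
  have "infsum A UNIV - infsum B UNIV = infsum R UNIV"
    using infsum_parity_split[OF has_sum_imp_summable[OF A]]
      infsum_parity_split[OF has_sum_imp_summable[OF B]]
      infsum_parity_split[OF has_sum_imp_summable[OF R]] 1 2 3
    by simp
  thus ?thesis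
    unfolding infsumI[OF A] infsumI[OF B] infsumI[OF R] by (simp add: algebra_simps)
qed

section \<open>The 5-dissection of Euler's product\<close>

text \<open>In the triple product with base q^3 the three factors run through the three residues
  modulo 3, which together make up E(q).\<close>

theorem pentagonal_number_theorem:
  assumes "q \<noteq> 0" "norm q < 1"
  shows "theta (q ^ 3) (- q) = qpoch_inf q q"
proof -
  have q3: "norm (q ^ 3) < 1"
    using assms by (simp add: norm_power power_less_one_iff)
  have "theta (q ^ 3) (- q) = qpoch_inf q (q ^ 3) * qpoch_inf (q ^ 2) (q ^ 3) * qpoch_inf (q ^ 3) (q ^ 3)"
    using Jacobi_triple_product[of "q ^ 3" "- q"] assms q3 by (simp add: eval_nat_numeral)
  also have "\<dots> = (\<Prod>j<3. qpoch_inf (q * q ^ j) (q ^ 3))"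
    by (simp add: eval_nat_numeral)
  also have "\<dots> = qpoch_inf q q"
    by (rule qpoch_inf_dissect[symmetric]) (use assms in auto)
  finally show ?thesis .
qed

text \<open>The quintuple product at p = x^5, w = -x: its factors are E H on the left and E G times
  E(x^5) = E G H on the right. Cancelling E H leaves E G^2.\<close>

lemma RR_G_sq_theta:
  assumes "x \<noteq> 0" "norm x < 1"
  shows "theta (x ^ 15) (- (x ^ 7)) + x * theta (x ^ 15) (- (x ^ 13)) = qpoch_inf x x * RR_G x ^ 2"
proof -
  have x5: "norm (x ^ 5) < 1"
    using assms by (simp add: norm_power power_less_one_iff)
  have E5: "theta ((x ^ 5) ^ 3) (- (x ^ 5)) = qpoch_inf x x * RR_G x * RR_H x"
    unfolding RR_G_RR_H[OF assms, symmetric]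
    by (rule pentagonal_number_theorem) (use assms x5 in auto)
  \<comment> \<open>This factor divides E(x^5), which is nonzero.\<close>
  have ne: "qpoch_inf x x * RR_H x \<noteq> 0"
    using RR_G_RR_H[OF assms] qpoch_inf_self_nonzero[OF x5] by auto
  have powers: "(x ^ 5) ^ 2 / (- x) ^ 3 = - (x ^ 7)" "(x ^ 5) ^ 2 * (- x) ^ 3 = - (x ^ 13)"
    using assms by (simp_all add: field_simps eval_nat_numeral)
  have "(qpoch_inf x x * RR_H x) * (theta (x ^ 15) (- (x ^ 7)) + x * theta (x ^ 15) (- (x ^ 13))) =
      (qpoch_inf x x * RR_G x) * (qpoch_inf x x * RR_G x * RR_H x)"
    using quintuple_product[of "x ^ 5" "- x"] assms x5
    unfolding E5 powers RR_G_theta[OF assms] RR_H_theta[OF assms] by (simp flip: power_mult)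
  also have "\<dots> = (qpoch_inf x x * RR_H x) * (qpoch_inf x x * RR_G x ^ 2)"
    by (simp add: power2_eq_square)
  finally show ?thesis
    using ne by simp
qed

text \<open>The same with w = - (x^2), which exchanges the roles of G and H; the series at - (x^4)
  must first be reflected to - x.\<close>

lemma RR_H_sq_theta:
  assumes "x \<noteq> 0" "norm x < 1"
  shows "theta (x ^ 15) (- (x ^ 4)) + x ^ 2 * theta (x ^ 15) (- (x ^ 16)) = qpoch_inf x x * RR_H x ^ 2"
proof -
  have x5: "norm (x ^ 5) < 1"
    using assms by (simp add: norm_power power_less_one_iff)
  have E5: "theta ((x ^ 5) ^ 3) (- (x ^ 5)) = qpoch_inf x x * RR_G x * RR_H x"
    unfolding RR_G_RR_H[OF assms, symmetric]
    by (rule pentagonal_number_theorem) (use assms x5 in auto)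
  have ne: "qpoch_inf x x * RR_G x \<noteq> 0"
    using RR_G_RR_H[OF assms] qpoch_inf_self_nonzero[OF x5] by auto
  have powers: "(x ^ 5) ^ 2 / (- (x ^ 2)) ^ 3 = - (x ^ 4)" "(x ^ 5) ^ 2 * (- (x ^ 2)) ^ 3 = - (x ^ 16)"
    using assms by (simp_all add: field_simps eval_nat_numeral)
  have "theta (x ^ 5) (- ((- (x ^ 2)) ^ 2)) = theta (x ^ 5) (x ^ 5 / (- ((- (x ^ 2)) ^ 2)))"
    using assms by (intro theta_reflect[symmetric]) auto
  also have "x ^ 5 / (- ((- (x ^ 2)) ^ 2)) = - x"
    using assms by (simp add: field_simps eval_nat_numeral)
  finally have H: "theta (x ^ 5) (- ((- (x ^ 2)) ^ 2)) = qpoch_inf x x * RR_H x"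
    by (simp only: RR_H_theta[OF assms])
  have "theta (x ^ 5) (- (x ^ 2)) *
      (theta ((x ^ 5) ^ 3) ((x ^ 5) ^ 2 / (- (x ^ 2)) ^ 3) -
       (- (x ^ 2)) * theta ((x ^ 5) ^ 3) ((x ^ 5) ^ 2 * (- (x ^ 2)) ^ 3)) =
      theta (x ^ 5) (- ((- (x ^ 2)) ^ 2)) * theta ((x ^ 5) ^ 3) (- (x ^ 5))"
    by (rule quintuple_product) (use assms x5 in auto)
  hence "(qpoch_inf x x * RR_G x) * (theta (x ^ 15) (- (x ^ 4)) + x ^ 2 * theta (x ^ 15) (- (x ^ 16))) =
      (qpoch_inf x x * RR_H x) * (qpoch_inf x x * RR_G x * RR_H x)"
    unfolding E5 H powers RR_G_theta[OF assms] by (simp flip: power_mult)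
  also have "\<dots> = (qpoch_inf x x * RR_G x) * (qpoch_inf x x * RR_H x ^ 2)"
    by (simp add: power2_eq_square)
  finally show ?thesis
    using ne by simp
qed

section \<open>Pentagonal exponents n (3 n - 1) / 2 modulo 5\<close>

definition pent_term :: "complex \<Rightarrow> int \<Rightarrow> complex" where
  "pent_term y = theta_term (y ^ 3) (- y)"

lemma theta_term_neg_powers:
  assumes "y \<noteq> 0"
  shows "theta_term (y ^ a) (- (y ^ b)) n =
     (if even n then 1 else - 1) * y powi (int a * tri n + int b * n)"
  using assms by (auto simp: theta_term_def power_int_minus_left power_int_add power_int_mult)

lemma pent_term_eq:
  assumes "y \<noteq> 0"
  shows "pent_term y n = (if even n then 1 else - 1) * y powi (3 * tri n + n)"
  using theta_term_neg_powers[OF assms, of 3 1 n] by (simp add: pent_term_def)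

lemma has_sum_residue_class:
  fixes f :: "int \<Rightarrow> complex"
  assumes "((\<lambda>k. f (5 * k + j)) has_sum S) UNIV"
  shows "(f has_sum S) {n. n mod 5 = j mod 5}"
proof -
  have "((\<lambda>k. f (5 * k + j)) has_sum S) UNIV \<longleftrightarrow> (f has_sum S) {n. n mod 5 = j mod 5}"
  proof (rule has_sum_reindex_bij_witness[of _ "\<lambda>n. (n - j) div 5" "\<lambda>k. 5 * k + j"])
    fix n assume "n \<in> {n. n mod 5 = j mod 5}"
    hence "5 dvd n - j"
      by (simp add: mod_eq_dvd_iff)
    thus "5 * ((n - j) div 5) + j = n"
      by simp
  qed auto
  thus ?thesis using assms by simp
qed

lemma has_sum_pent_term_class:
  fixes j :: int and b :: nat
  assumes "y \<noteq> 0" "norm y < 1"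
    and "\<And>k. pent_term y (5 * k + j) = c * theta_term ((y ^ 5) ^ 15) (- ((y ^ 5) ^ b)) k"
  shows "(pent_term y has_sum c * theta ((y ^ 5) ^ 15) (- ((y ^ 5) ^ b))) {n. n mod 5 = j mod 5}"
proof (rule has_sum_residue_class)
  have "norm ((y ^ 5) ^ 15) < 1"
    using assms(2) by (simp add: norm_power power_less_one_iff flip: power_mult)
  thus "((\<lambda>k. pent_term y (5 * k + j)) has_sum c * theta ((y ^ 5) ^ 15) (- ((y ^ 5) ^ b))) UNIV"
    unfolding assms(3) using assms(1) by (intro has_sum_cmult_right has_sum_theta) auto
qed

lemma pent_exponent_residue:
  "3 * tri (5 * k + j) + (5 * k + j) = 75 * tri k + (15 * j + 35) * k + (3 * tri j + j)"
proof -
  have "3 * tri (5 * k) + 5 * k = 75 * tri k + 35 * k"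
    using two_tri[of "5 * k"] two_tri[of k] by simp
  thus ?thesis
    by (simp add: tri_add algebra_simps)
qed

text \<open>On n = 5 k + j the exponent is again quadratic in k, with nonconstant part divisible by
  5, so each class is a monomial times a theta series in y^5. The constant exponent is split as e +
  5 d to separate the power of y^5; the sign alternates with k because 5 is odd.\<close>

lemma pent_term_residue:
  assumes "y \<noteq> 0" "3 * tri j + j = int e + 5 * int d" "15 * j + 35 = 5 * int b"
  shows "pent_term y (5 * k + j) =
     ((if even j then 1 else - 1) * y ^ e * (y ^ 5) ^ d) * theta_term ((y ^ 5) ^ 15) (- ((y ^ 5) ^ b)) k"
proof -
  have "3 * tri (5 * k + j) + (5 * k + j) = (int e + int (5 * d)) + 5 * (15 * tri k + int b * k)"
    unfolding pent_exponent_residue assms(2,3) by (simp add: algebra_simps)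
  also have "y powi \<dots> = y ^ e * y ^ (5 * d) * y powi (5 * (15 * tri k + int b * k))"
    by (simp only: power_int_add[OF disjI1[OF assms(1)]] power_int_of_nat)
  also have "\<dots> = y ^ e * (y ^ 5) ^ d * ((y ^ 5) powi (15 * tri k + int b * k))"
    using power_int_mult[of y 5 "15 * tri k + int b * k"] by (simp only: power_mult power_int_numeral)
  finally have "y powi (3 * tri (5 * k + j) + (5 * k + j)) = \<dots>" .
  thus ?thesis
    using assms(1) unfolding pent_term_eq[OF assms(1)]
    by (subst theta_term_neg_powers) auto
qed

definition gpent :: "int \<Rightarrow> nat" where
  "gpent n = nat (3 * tri n + n)"

lemma int_gpent: "int (gpent n) = 3 * tri n + n"
proof -
  have "0 \<le> n * (3 * n - 1)"
    by (cases "n \<le> 0") (auto intro: mult_nonpos_nonpos)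
  also have "n * (3 * n - 1) = 2 * (3 * tri n + n)"
    using two_tri[of n] by (simp add: algebra_simps)
  finally show ?thesis
    by (simp add: gpent_def)
qed

lemma pent_term_gpent:
  assumes "y \<noteq> 0"
  shows "pent_term y n = (if even n then 1 else - 1) * y ^ gpent n"
  unfolding pent_term_eq[OF assms] int_gpent[symmetric] by simp

text \<open>Residues 3 and 4 never occur: 24 e + 1 = (6 n - 1)^2 for a pentagonal exponent e, so 1 -
  e is a square modulo 5.\<close>

lemma gpent_mod_5:
  "gpent n mod 5 = (if n mod 5 = 0 \<or> n mod 5 = 2 then 0 else if n mod 5 = 1 then 1 else 2)"
proof -
  define j where "j = n mod 5"
  have "int (gpent n) = 5 * (15 * tri (n div 5) + (3 * j + 7) * (n div 5)) + (3 * tri j + j)"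
    using pent_exponent_residue[of "n div 5" j] unfolding int_gpent j_def by (simp add: algebra_simps)
  hence "int (gpent n) mod 5 = (3 * tri j + j) mod 5"
    by (simp only: mod_mult_self4)
  moreover have "j = 0 \<or> j = 1 \<or> j = 2 \<or> j = 3 \<or> j = 4"
    unfolding j_def by presburger
  ultimately have "int (gpent n mod 5) = (if j = 0 \<or> j = 2 then 0 else if j = 1 then 1 else 2)"
    by (elim disjE) (simp_all add: tri_def zmod_int)
  thus ?thesis
    unfolding j_def by (auto split: if_splits)
qed

text \<open>The classes n = 0 and n = 2 modulo 5 give exactly the two theta series that the
  quintuple product combines into E G^2.\<close>

lemma has_sum_pent_term_0:
  assumes "y \<noteq> 0" "norm y < 1"
  shows "(pent_term y has_sum qpoch_inf (y ^ 5) (y ^ 5) * RR_G (y ^ 5) ^ 2) {n. gpent n mod 5 = 0}"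
proof -
  have y5: "y ^ 5 \<noteq> 0" "norm (y ^ 5) < 1"
    using assms by (simp_all add: norm_power power_less_one_iff)
  have "(pent_term y has_sum 1 * theta ((y ^ 5) ^ 15) (- ((y ^ 5) ^ 7))) {n. n mod 5 = 0 mod 5}"
    by (rule has_sum_pent_term_class[OF assms])
       (use pent_term_residue[OF assms(1), of 0 0 0 7] in simp)
  moreover have "(pent_term y has_sum y ^ 5 * theta ((y ^ 5) ^ 15) (- ((y ^ 5) ^ 13))) {n. n mod 5 = 2 mod 5}"
    by (rule has_sum_pent_term_class[OF assms])
       (use pent_term_residue[OF assms(1), of 2 0 1 13] in \<open>simp add: tri_def\<close>)
  ultimately have "(pent_term y has_sum 1 * theta ((y ^ 5) ^ 15) (- ((y ^ 5) ^ 7)) +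
      y ^ 5 * theta ((y ^ 5) ^ 15) (- ((y ^ 5) ^ 13))) ({n. n mod 5 = 0 mod 5} \<union> {n. n mod 5 = 2 mod 5})"
    by (rule has_sum_Un_disjoint) auto
  moreover have "{n. n mod 5 = 0 mod 5} \<union> {n. n mod 5 = 2 mod 5} = {n :: int. gpent n mod 5 = 0}"
    by (auto simp: gpent_mod_5 split: if_splits)
  ultimately show ?thesis
    using RR_G_sq_theta[OF y5] by simp
qed

text \<open>Only the class n = 1 contributes, and after reflection its theta series is again a
  pentagonal one, namely that of E(y^25). This self-similarity ties the middle term to the Hecke
  operator.\<close>

lemma has_sum_pent_term_1:
  assumes "y \<noteq> 0" "norm y < 1"
  shows "(pent_term y has_sum - y * (qpoch_inf (y ^ 5) (y ^ 5) * RR_G (y ^ 5) * RR_H (y ^ 5)))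
           {n. gpent n mod 5 = 1}"
proof -
  define x where "x = y ^ 5"
  have x: "x \<noteq> 0" "norm x < 1"
    using assms by (simp_all add: x_def norm_power power_less_one_iff)
  have x5: "norm (x ^ 5) < 1"
    using x by (simp add: norm_power power_less_one_iff)
  have "(pent_term y has_sum - y * theta ((y ^ 5) ^ 15) (- ((y ^ 5) ^ 10))) {n. n mod 5 = 1 mod 5}"
    by (rule has_sum_pent_term_class[OF assms])
       (use pent_term_residue[OF assms(1), of 1 1 0 10] in simp)
  moreover have "{n. n mod 5 = 1 mod 5} = {n :: int. gpent n mod 5 = 1}"
    by (auto simp: gpent_mod_5 split: if_splits)
  moreover have "theta (x ^ 15) (- (x ^ 10)) = qpoch_inf x x * RR_G x * RR_H x"
  proof -
    have "theta (x ^ 15) (- (x ^ 10)) = theta (x ^ 15) (x ^ 15 / (- (x ^ 10)))"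
      using x by (intro theta_reflect[symmetric]) auto
    also have "x ^ 15 / (- (x ^ 10)) = - (x ^ 5)"
      using x by (simp add: field_simps flip: power_add)
    also have "theta (x ^ 15) (- (x ^ 5)) = theta ((x ^ 5) ^ 3) (- (x ^ 5))"
      by (simp flip: power_mult)
    also have "\<dots> = qpoch_inf (x ^ 5) (x ^ 5)"
      by (rule pentagonal_number_theorem) (use x x5 in auto)
    finally show ?thesis
      by (simp only: RR_G_RR_H[OF x])
  qed
  ultimately show ?thesis
    by (simp add: x_def)
qed

lemma has_sum_pent_term_2:
  assumes "y \<noteq> 0" "norm y < 1"
  shows "(pent_term y has_sum - (y ^ 2) * (qpoch_inf (y ^ 5) (y ^ 5) * RR_H (y ^ 5) ^ 2))
           {n. gpent n mod 5 = 2}"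
proof -
  define x where "x = y ^ 5"
  have x: "x \<noteq> 0" "norm x < 1"
    using assms by (simp_all add: x_def norm_power power_less_one_iff)
  \<comment> \<open>The representative -1 instead of 4 makes the inner exponent 4, as
    \<open>RR_H_sq_theta\<close> requires; 4 would give 19.\<close>
  have "(pent_term y has_sum - (y ^ 2) * theta (x ^ 15) (- (x ^ 4))) {n. n mod 5 = (- 1) mod 5}"
    unfolding x_def
    by (rule has_sum_pent_term_class[OF assms])
       (use pent_term_residue[OF assms(1), of "- 1" 2 0 4] in \<open>simp add: tri_def\<close>)
  moreover have "(pent_term y has_sum (- (y ^ 2) * x ^ 2) * theta (x ^ 15) (- (x ^ 16))) {n. n mod 5 = 3 mod 5}"
    unfolding x_def
    by (rule has_sum_pent_term_class[OF assms])
       (use pent_term_residue[OF assms(1), of 3 2 2 16] in \<open>simp add: tri_def\<close>)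
  ultimately have "(pent_term y has_sum - (y ^ 2) * theta (x ^ 15) (- (x ^ 4)) +
      (- (y ^ 2) * x ^ 2) * theta (x ^ 15) (- (x ^ 16))) ({n. n mod 5 = (- 1) mod 5} \<union> {n. n mod 5 = 3 mod 5})"
    by (rule has_sum_Un_disjoint) auto
  moreover have "{n. n mod 5 = (- 1) mod 5} \<union> {n. n mod 5 = 3 mod 5} = {n :: int. gpent n mod 5 = 2}"
    by (simp add: gpent_mod_5 set_eq_iff) presburger
  moreover have "- (y ^ 2) * theta (x ^ 15) (- (x ^ 4)) + (- (y ^ 2) * x ^ 2) * theta (x ^ 15) (- (x ^ 16)) =
      - (y ^ 2) * (qpoch_inf x x * RR_H x ^ 2)"
    unfolding RR_H_sq_theta[OF x, symmetric] by (simp add: algebra_simps)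
  ultimately show ?thesis
    unfolding x_def by simp
qed

section \<open>The Hecke operator on eta products\<close>

text \<open>Collects the monomials of equal exponent, so that the coefficients of a power series can
  be read off an unordered double sum.\<close>

lemma sums_infsum_fibres:
  fixes w :: "'a \<Rightarrow> complex" and e :: "'a \<Rightarrow> nat"
  assumes "(\<lambda>i. w i * x ^ e i) summable_on J"
  shows "(\<lambda>n. infsum w {i \<in> J. e i = n} * x ^ n) sums infsum (\<lambda>i. w i * x ^ e i) J"
proof -
  let ?F = "\<lambda>i. w i * x ^ e i"
  let ?B = "\<lambda>n. {i \<in> J. e i = n}"
  have "((\<lambda>(n, i). ?F i) has_sum infsum ?F J) (Sigma UNIV ?B) \<longleftrightarrow> (?F has_sum infsum ?F J) J"
    by (rule has_sum_reindex_bij_witness[of _ "\<lambda>i. (e i, i)" snd]) auto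
  hence "((\<lambda>(n, i). ?F i) has_sum infsum ?F J) (Sigma UNIV ?B)"
    using assms by simp
  moreover have "((\<lambda>i. (\<lambda>(n, i). ?F i) (n, i)) has_sum infsum w (?B n) * x ^ n) (?B n)" for n
  proof -
    have "?F summable_on ?B n"
      by (rule summable_on_subset_banach[OF assms]) auto
    moreover have "infsum ?F (?B n) = infsum (\<lambda>i. w i * x ^ n) (?B n)"
      by (rule infsum_cong) auto
    ultimately show ?thesis
      by (simp add: has_sum_iff infsum_cmult_left')
  qed
  ultimately have "((\<lambda>n. infsum w (?B n) * x ^ n) has_sum infsum ?F J) UNIV"
    by (rule has_sum_SigmaD)
  thus ?thesis by (rule has_sum_imp_sums)
qed

lemma q_pow_add: "q_pow \<tau> (a + b) = q_pow \<tau> a * q_pow \<tau> b"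
  by (simp add: q_pow_def ring_distribs exp_add)

lemma q_pow_power: "q_pow \<tau> a ^ n = q_pow \<tau> (real n * a)"
  by (simp add: q_pow_def mult_ac flip: exp_of_nat_mult)

lemma q_pow_of_nat_mult: "q_pow (of_nat r * \<tau>) a = q_pow \<tau> (real r * a)"
  by (simp add: q_pow_def mult_ac)

lemma q_pow_nonzero [simp]: "q_pow \<tau> a \<noteq> 0"
  by (simp add: q_pow_def)

lemma norm_q_pow_less_1:
  assumes "Im \<tau> > 0" "a > 0"
  shows "norm (q_pow \<tau> a) < 1"
  using assms by (simp add: q_pow_def)

text \<open>Divisibility of r + s by 24 makes the fractional prefactors of the two eta functions
  combine to an integral power, hence a q-expansion with natural exponents.\<close>

lemma dedekind_eta_product:
  assumes "r + s = 24 * N"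
  shows "dedekind_eta (of_nat r * \<tau>) * dedekind_eta (of_nat s * \<tau>) =
    q_pow \<tau> 1 ^ N * (qpoch_inf (q_pow \<tau> 1 ^ r) (q_pow \<tau> 1 ^ r) * qpoch_inf (q_pow \<tau> 1 ^ s) (q_pow \<tau> 1 ^ s))"
proof -
  have "real r + real s = 24 * real N"
    using assms by (metis of_nat_add of_nat_mult of_nat_numeral)
  hence "real N * 1 = real r * (1 / 24) + real s * (1 / 24)"
    by simp
  hence "q_pow \<tau> 1 ^ N = q_pow \<tau> (real r * (1 / 24)) * q_pow \<tau> (real s * (1 / 24))"
    by (simp only: q_pow_power q_pow_add)
  thus ?thesis
    by (simp add: dedekind_eta_def q_pow_of_nat_mult q_pow_power)
qed

definition pent_sign :: "int \<times> int \<Rightarrow> complex" where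
  "pent_sign = (\<lambda>(m, n). (if even m then 1 else - 1) * (if even n then 1 else - 1))"

definition pent_pair :: "nat \<Rightarrow> nat \<Rightarrow> nat \<Rightarrow> int \<times> int \<Rightarrow> nat" where
  "pent_pair N r s = (\<lambda>(m, n). N + r * gpent m + s * gpent n)"

lemma pent_sign_pair:
  assumes "x \<noteq> 0"
  shows "pent_sign i * x ^ pent_pair N r s i =
    x ^ N * (case i of (m, n) \<Rightarrow> pent_term (x ^ r) m * pent_term (x ^ s) n)"
  using assms
  by (cases i) (simp add: pent_sign_def pent_pair_def pent_term_gpent power_add power_mult)

lemma has_sum_pent_pair_UNIV:
  assumes "x \<noteq> 0" "norm x < 1" "r > 0" "s > 0"
  shows "((\<lambda>i. pent_sign i * x ^ pent_pair N r s i) has_sum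
           x ^ N * (qpoch_inf (x ^ r) (x ^ r) * qpoch_inf (x ^ s) (x ^ s))) UNIV"
proof -
  have *: "norm (x ^ k) < 1" "norm ((x ^ k) ^ 3) < 1" if "k > 0" for k
    using assms that by (simp_all add: norm_power power_less_one_iff flip: power_mult)
  have "((\<lambda>(m, n). pent_term (x ^ r) m * pent_term (x ^ s) n) has_sum
          theta ((x ^ r) ^ 3) (- (x ^ r)) * theta ((x ^ s) ^ 3) (- (x ^ s))) UNIV"
    unfolding pent_term_def using assms * by (intro has_sum_theta_times) auto
  from has_sum_cmult_right[OF this, of "x ^ N"] show ?thesis
    using assms * by (simp add: pent_sign_pair pentagonal_number_theorem)
qed

text \<open>The coefficients a(5n) come from the series in y = q^(1/5), restricted to exponents
  divisible by 5; the coefficients a(n/5) give the eta product at 5 \<tau>. Defining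
  \<open>y\<close> through \<tau> fixes the fifth root.\<close>

lemma hecke_T5_eta_product:
  fixes \<tau> :: complex and r s N :: nat
  assumes "r > 0" "s > 0" "r + s = 24 * N" "Im \<tau> > 0"
  defines "y \<equiv> q_pow \<tau> (1 / 5)"
  shows "hecke_T5 (\<lambda>t. dedekind_eta (of_nat r * t) * dedekind_eta (of_nat s * t)) \<tau> =
     y ^ N * infsum (\<lambda>(m, n). pent_term (y ^ r) m * pent_term (y ^ s) n) {i. 5 dvd pent_pair N r s i} +
     (y ^ 25) ^ N * (qpoch_inf ((y ^ 25) ^ r) ((y ^ 25) ^ r) * qpoch_inf ((y ^ 25) ^ s) ((y ^ 25) ^ s))"
proof -
  let ?f = "\<lambda>t. dedekind_eta (of_nat r * t) * dedekind_eta (of_nat s * t)"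
  let ?e = "pent_pair N r s"
  define a where "a = (\<lambda>n. infsum pent_sign {i. ?e i = n})"
  define x where "x = q_pow \<tau> 1"
  have xy: "x = y ^ 5"
    unfolding x_def y_def by (simp add: q_pow_power)
  have y: "y \<noteq> 0" "norm y < 1"
    using norm_q_pow_less_1[OF assms(4)] by (simp_all add: y_def)
  have a: "has_q_expansion ?f a"
    unfolding has_q_expansion_def
  proof (intro allI impI)
    fix t :: complex assume t: "Im t > 0"
    have "((\<lambda>i. pent_sign i * q_pow t 1 ^ ?e i) has_sum ?f t) UNIV"
      unfolding dedekind_eta_product[OF assms(3)]
      using norm_q_pow_less_1[OF t, of 1] assms by (intro has_sum_pent_pair_UNIV) auto
    from sums_infsum_fibres[OF has_sum_imp_summable[OF this]]
    show "(\<lambda>n. a n * q_pow t 1 ^ n) sums ?f t"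
      using infsumI[OF \<open>((\<lambda>i. pent_sign i * q_pow t 1 ^ ?e i) has_sum ?f t) UNIV\<close>]
      by (simp add: a_def)
  qed
  hence "hecke_T5 ?f \<tau> = (\<Sum>n. hecke_T5_coeff a n * x ^ n)"
    unfolding hecke_T5_def x_def
    by (subst the_equality[of "has_q_expansion ?f" a]) (auto intro: has_q_expansion_unique)
  moreover have "(\<lambda>n. hecke_T5_coeff a n * x ^ n) sums
      (y ^ N * infsum (\<lambda>(m, n). pent_term (y ^ r) m * pent_term (y ^ s) n) {i. 5 dvd ?e i} + ?f (5 * \<tau>))"
  proof -
    let ?J = "{i. 5 dvd ?e i}"
    have eq: "pent_sign i * x ^ (?e i div 5) = pent_sign i * y ^ ?e i" if "i \<in> ?J" for i
      using that by (simp add: xy flip: power_mult)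
    have "(\<lambda>i. pent_sign i * y ^ ?e i) summable_on ?J"
      using has_sum_imp_summable[OF has_sum_pent_pair_UNIV[OF y assms(1,2)]]
      by (rule summable_on_subset_banach) auto
    hence "(\<lambda>i. pent_sign i * x ^ (?e i div 5)) summable_on ?J"
      by (subst summable_on_cong[OF eq])
    from sums_infsum_fibres[OF this]
    have "(\<lambda>n. infsum pent_sign {i \<in> ?J. ?e i div 5 = n} * x ^ n) sums
            infsum (\<lambda>i. pent_sign i * y ^ ?e i) ?J"
      by (simp only: infsum_cong[OF eq])
    moreover have "{i \<in> ?J. ?e i div 5 = n} = {i. ?e i = 5 * n}" for n
      by auto
    moreover have "infsum (\<lambda>i. pent_sign i * y ^ ?e i) ?J =
        y ^ N * infsum (\<lambda>(m, n). pent_term (y ^ r) m * pent_term (y ^ s) n) ?J"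
      unfolding pent_sign_pair[OF y(1)] infsum_cmult_right' ..
    ultimately have 1: "(\<lambda>n. a (5 * n) * x ^ n) sums
        (y ^ N * infsum (\<lambda>(m, n). pent_term (y ^ r) m * pent_term (y ^ s) n) ?J)"
      by (simp add: a_def)
    have "(\<lambda>n. a n * q_pow (5 * \<tau>) 1 ^ n) sums ?f (5 * \<tau>)"
      using a assms(4) unfolding has_q_expansion_def by simp
    moreover have "q_pow (5 * \<tau>) 1 = x ^ 5"
      using q_pow_of_nat_mult[of 5 \<tau> 1] by (simp add: x_def q_pow_power)
    ultimately have "(\<lambda>n. (if 5 dvd 5 * n then a (5 * n div 5) else 0) * x ^ (5 * n)) sums ?f (5 * \<tau>)"
      by (simp add: power_mult)
    \<comment> \<open>The series in q^5 is a series in q padded with zeros.\<close>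
    hence 2: "(\<lambda>n. (if 5 dvd n then a (n div 5) else 0) * x ^ n) sums ?f (5 * \<tau>)"
      by (subst (asm) sums_mono_reindex[of "\<lambda>n. 5 * n"]) (auto simp: strict_mono_def elim!: dvdE)
    from sums_add[OF 1 2] show ?thesis
      by (simp add: hecke_T5_coeff_def ring_distribs)
  qed
  moreover have "?f (5 * \<tau>) = (y ^ 25) ^ N *
      (qpoch_inf ((y ^ 25) ^ r) ((y ^ 25) ^ r) * qpoch_inf ((y ^ 25) ^ s) ((y ^ 25) ^ s))"
  proof -
    have "q_pow (5 * \<tau>) 1 = y ^ 25"
      using q_pow_of_nat_mult[of 5 \<tau> 1] by (simp add: y_def q_pow_power)
    thus ?thesis
      unfolding dedekind_eta_product[OF assms(3)] by simp
  qed
  ultimately show ?thesis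
    by (simp add: sums_iff)
qed

section \<open>The pairs of residue classes that survive the Hecke operator\<close>

lemma has_sum_pent_term_prod:
  assumes "x \<noteq> 0" "norm x < 1" "z \<noteq> 0" "norm z < 1"
    and "(pent_term x has_sum S) A" "(pent_term z has_sum T) B"
  shows "((\<lambda>(m, n). pent_term x m * pent_term z n) has_sum S * T) (A \<times> B)"
proof (rule has_sum_times)
  have *: "norm (u ^ 3) < 1" if "norm u < 1" for u :: complex
    using that by (simp add: norm_power power_less_one_iff)
  show "(\<lambda>m. norm (pent_term x m)) summable_on A"
    unfolding pent_term_def by (rule abs_summable_theta_term) (use assms * in auto)
  show "(\<lambda>n. norm (pent_term z n)) summable_on B"
    unfolding pent_term_def by (rule abs_summable_theta_term) (use assms * in auto)
qed (use assms in auto)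

lemma gpent_mod_5_cases: "gpent n mod 5 = 0 \<or> gpent n mod 5 = 1 \<or> gpent n mod 5 = 2"
  by (simp add: gpent_mod_5)

abbreviation pent_class :: "nat \<Rightarrow> int set" where
  "pent_class k \<equiv> {n. gpent n mod 5 = k}"

text \<open>From 24 N = r + s also 5 divides N, and s = -r modulo 5, so the exponent is r (gpent m -
  gpent n) modulo 5, where r is invertible.\<close>

lemma pent_pair_dvd_5_opposite:
  assumes "r + s = 24 * N" "5 dvd r + s" "\<not> 5 dvd r"
  shows "{i. 5 dvd pent_pair N r s i} =
    pent_class 0 \<times> pent_class 0 \<union> pent_class 1 \<times> pent_class 1 \<union> pent_class 2 \<times> pent_class 2"
proof -
  have "5 dvd pent_pair N r s (m, n) \<longleftrightarrow> gpent m mod 5 = gpent n mod 5" for m n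
  proof -
    have "5 dvd N"
      using assms(1,2) by presburger
    then obtain c where c: "int N = 5 * c"
      by (metis dvdE of_nat_mult of_nat_numeral)
    obtain d where d: "int s = 5 * d - int r"
    proof -
      have "5 dvd int r + int s"
        using assms(2) by presburger
      then obtain d where "int r + int s = 5 * d" ..
      thus ?thesis
        by (intro that[of d]) simp
    qed
    have "int (pent_pair N r s (m, n)) =
        5 * (c + d * int (gpent n)) + int r * (int (gpent m) - int (gpent n))"
      by (simp add: pent_pair_def c d algebra_simps)
    hence "5 dvd int (pent_pair N r s (m, n)) \<longleftrightarrow> 5 dvd int r * (int (gpent m) - int (gpent n))"
      by (metis dvd_add_right_iff dvd_triv_left)
    also have "\<dots> \<longleftrightarrow> 5 dvd int (gpent m) - int (gpent n)"
    proof -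
      have "prime (5 :: int)"
        by simp
      thus ?thesis
        using assms(3) int_dvd_int_iff[of 5 r] by (auto simp: prime_dvd_mult_iff)
    qed
    also have "\<dots> \<longleftrightarrow> int (gpent m) mod 5 = int (gpent n) mod 5"
      by (rule mod_eq_dvd_iff[symmetric])
    also have "\<dots> \<longleftrightarrow> gpent m mod 5 = gpent n mod 5"
      using cong_int_iff[of "gpent m" "gpent n" 5] by (simp add: cong_def)
    finally show ?thesis
      using int_dvd_int_iff[of 5 "pent_pair N r s (m, n)"] by simp
  qed
  moreover have "gpent m mod 5 = gpent n mod 5 \<longleftrightarrow>
      (gpent m mod 5 = 0 \<and> gpent n mod 5 = 0) \<or> (gpent m mod 5 = 1 \<and> gpent n mod 5 = 1) \<or>
      (gpent m mod 5 = 2 \<and> gpent n mod 5 = 2)" for m n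
    using gpent_mod_5_cases[of m] by auto
  ultimately show ?thesis
    by auto
qed

text \<open>Modulo 5 both s = r and N = -2 r, so the exponent is r (gpent m + gpent n - 2). As
  residues lie in {0, 1, 2}, their sum is at most 4 and must equal 2.\<close>

lemma pent_pair_dvd_5_same:
  assumes "r + s = 24 * N" "r mod 5 = s mod 5" "\<not> 5 dvd r"
  shows "{i. 5 dvd pent_pair N r s i} =
    pent_class 0 \<times> pent_class 2 \<union> pent_class 1 \<times> pent_class 1 \<union> pent_class 2 \<times> pent_class 0"
proof -
  have "5 dvd pent_pair N r s (m, n) \<longleftrightarrow> (gpent m + gpent n) mod 5 = 2" for m n
  proof -
    obtain d where d: "int s = int r + 5 * d"
    proof -
      have "5 dvd int s - int r"
        using assms(2) by presburger
      then obtain d where "int s - int r = 5 * d" ..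
      thus ?thesis
        by (intro that[of d]) simp
    qed
    \<comment> \<open>Writing N as 25 N - 24 N exhibits N = - (r + s) modulo 5.\<close>
    have N: "int N = 25 * int N - (int r + int s)"
      using assms(1) by simp
    have "int (pent_pair N r s (m, n)) =
        5 * (5 * int N - d + d * int (gpent n)) + int r * (int (gpent m) + int (gpent n) - 2)"
      using N by (simp add: pent_pair_def d algebra_simps)
    hence "5 dvd int (pent_pair N r s (m, n)) \<longleftrightarrow> 5 dvd int r * (int (gpent m) + int (gpent n) - 2)"
      by (metis dvd_add_right_iff dvd_triv_left)
    also have "\<dots> \<longleftrightarrow> 5 dvd int (gpent m) + int (gpent n) - 2"
    proof -
      have "prime (5 :: int)"
        by simp
      thus ?thesis
        using assms(3) int_dvd_int_iff[of 5 r] by (auto simp: prime_dvd_mult_iff)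
    qed
    also have "\<dots> \<longleftrightarrow> int (gpent m + gpent n) mod 5 = 2 mod 5"
      unfolding mod_eq_dvd_iff by simp
    also have "\<dots> \<longleftrightarrow> (gpent m + gpent n) mod 5 = 2"
      using cong_int_iff[of "gpent m + gpent n" 2 5] by (simp add: cong_def)
    finally show ?thesis
      using int_dvd_int_iff[of 5 "pent_pair N r s (m, n)"] by simp
  qed
  moreover have "(gpent m + gpent n) mod 5 = 2 \<longleftrightarrow>
      (gpent m mod 5 = 0 \<and> gpent n mod 5 = 2) \<or> (gpent m mod 5 = 1 \<and> gpent n mod 5 = 1) \<or>
      (gpent m mod 5 = 2 \<and> gpent n mod 5 = 0)" for m n
    using gpent_mod_5_cases[of m] gpent_mod_5_cases[of n]
    unfolding mod_add_eq[of "gpent m" 5 "gpent n", symmetric] by (elim disjE) simp_all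
  ultimately show ?thesis
    by auto
qed

lemma has_sum_three_classes:
  assumes "x \<noteq> 0" "norm x < 1" "z \<noteq> 0" "norm z < 1"
    and "\<And>k. k < 3 \<Longrightarrow> (pent_term x has_sum S k) (pent_class k)"
    and "\<And>k. k < 3 \<Longrightarrow> (pent_term z has_sum T k) (pent_class k)"
    and "a < 3" "b < 3" "c < 3"
  shows "infsum (\<lambda>(m, n). pent_term x m * pent_term z n)
      (pent_class 0 \<times> pent_class a \<union> pent_class 1 \<times> pent_class b \<union> pent_class 2 \<times> pent_class c) =
    S 0 * T a + S 1 * T b + S 2 * T c"
  by (rule infsumI, intro has_sum_Un_disjoint has_sum_pent_term_prod assms) auto

definition pent_class_sum :: "complex \<Rightarrow> nat \<Rightarrow> complex" where
  "pent_class_sum y k = qpoch_inf (y ^ 5) (y ^ 5) *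
     (if k = 0 then RR_G (y ^ 5) ^ 2
      else if k = 1 then - y * (RR_G (y ^ 5) * RR_H (y ^ 5))
      else - (y ^ 2) * RR_H (y ^ 5) ^ 2)"

lemma has_sum_pent_class_sum:
  assumes "y \<noteq> 0" "norm y < 1" "k < 3"
  shows "(pent_term y has_sum pent_class_sum y k) (pent_class k)"
proof -
  have "k = 0 \<or> k = 1 \<or> k = 2"
    using assms(3) by auto
  thus ?thesis
    using has_sum_pent_term_0[OF assms(1,2)] has_sum_pent_term_1[OF assms(1,2)]
      has_sum_pent_term_2[OF assms(1,2)]
    by (elim disjE) (simp_all add: pent_class_sum_def mult_ac)
qed

lemma hecke_T5_eta_product_classes:
  fixes \<tau> :: complex and r s N :: nat
  assumes "r > 0" "s > 0" "r + s = 24 * N" "Im \<tau> > 0"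
    and "{i. 5 dvd pent_pair N r s i} =
      pent_class 0 \<times> pent_class a \<union> pent_class 1 \<times> pent_class b \<union> pent_class 2 \<times> pent_class c"
    and "a < 3" "b < 3" "c < 3"
  defines "y \<equiv> q_pow \<tau> (1 / 5)"
  shows "hecke_T5 (\<lambda>t. dedekind_eta (of_nat r * t) * dedekind_eta (of_nat s * t)) \<tau> =
     y ^ N * (pent_class_sum (y ^ r) 0 * pent_class_sum (y ^ s) a +
       pent_class_sum (y ^ r) 1 * pent_class_sum (y ^ s) b +
       pent_class_sum (y ^ r) 2 * pent_class_sum (y ^ s) c) +
     y ^ N * (pent_class_sum (y ^ r) 1 * pent_class_sum (y ^ s) 1)"
proof -
  have y: "y \<noteq> 0" "norm y < 1"
    using norm_q_pow_less_1[OF assms(4)] by (simp_all add: y_def)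
  have yk: "y ^ k \<noteq> 0" "norm (y ^ k) < 1" if "k > 0" for k
    using y that by (simp_all add: norm_power power_less_one_iff)
  \<comment> \<open>The factors of the second Hecke summand are, up to sign, the middle terms of the
    dissection.\<close>
  have E25: "y ^ k * qpoch_inf ((y ^ 25) ^ k) ((y ^ 25) ^ k) = - pent_class_sum (y ^ k) 1" if "k > 0" for k
  proof -
    have "(y ^ 25) ^ k = ((y ^ k) ^ 5) ^ 5"
      by (simp add: mult_ac flip: power_mult)
    moreover have "(y ^ k) ^ 5 \<noteq> 0" "norm ((y ^ k) ^ 5) < 1"
      using yk[OF that] by (simp_all add: norm_power power_less_one_iff)
    ultimately show ?thesis
      using RR_G_RR_H[of "(y ^ k) ^ 5"] by (simp add: pent_class_sum_def mult_ac)
  qed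
  \<comment> \<open>25 N = N + 24 N supplies the powers y^r and y^s that these middle terms
    need.\<close>
  have "(y ^ 25) ^ N = y ^ (N + (r + s))"
    unfolding assms(3) by (simp flip: power_mult)
  hence "(y ^ 25) ^ N * (qpoch_inf ((y ^ 25) ^ r) ((y ^ 25) ^ r) * qpoch_inf ((y ^ 25) ^ s) ((y ^ 25) ^ s)) =
      y ^ N * ((y ^ r * qpoch_inf ((y ^ 25) ^ r) ((y ^ 25) ^ r)) *
               (y ^ s * qpoch_inf ((y ^ 25) ^ s) ((y ^ 25) ^ s)))"
    by (simp add: power_add)
  also have "\<dots> = y ^ N * (pent_class_sum (y ^ r) 1 * pent_class_sum (y ^ s) 1)"
    using E25[OF assms(1)] E25[OF assms(2)] by simp
  finally show ?thesis
    unfolding hecke_T5_eta_product[OF assms(1-4), folded y_def] assms(5)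
    by (subst has_sum_three_classes[where S = "pent_class_sum (y ^ r)" and T = "pent_class_sum (y ^ s)"])
       (use assms yk in \<open>auto intro: has_sum_pent_class_sum\<close>)
qed

theorem theorem1p1:
  fixes r s :: nat and \<tau> q :: complex
  assumes "r > 0" and "s > 0"
    and "[r + s = 0] (mod 24)"
    and "\<not> (5 dvd r \<and> 5 dvd s)"
    and "Im \<tau> > 0"
    and "q = exp (2 * of_real pi * \<i> * \<tau>)"
  shows "([r + s = 0] (mod 5) \<longrightarrow>
           hecke_T5 (\<lambda>t. dedekind_eta (of_nat r * t) * dedekind_eta (of_nat s * t)) \<tau> =
             dedekind_eta (of_nat r * \<tau>) * dedekind_eta (of_nat s * \<tau>) *
               (q_pow \<tau> (- (real r + real s) / 60) * RR_U r s q) ^ 2) \<and>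
         ([int r - int s = 0] (mod 5) \<longrightarrow>
           hecke_T5 (\<lambda>t. dedekind_eta (of_nat r * t) * dedekind_eta (of_nat s * t)) \<tau> =
             - (dedekind_eta (of_nat r * \<tau>) * dedekind_eta (of_nat s * \<tau>) *
               (q_pow \<tau> ((11 * real r - real s) / 60) * RR_U r s q) ^ 2))"
proof (intro conjI impI)
  let ?T = "hecke_T5 (\<lambda>t. dedekind_eta (of_nat r * t) * dedekind_eta (of_nat s * t)) \<tau>"
  obtain N where N: "r + s = 24 * N"
    using assms(3) by (auto simp: cong_0_iff)
  have rsN: "real r + real s = 24 * real N"
    using N by (metis of_nat_add of_nat_mult of_nat_numeral)
  define y where "y = q_pow \<tau> (1 / 5)"
  have y: "y \<noteq> 0"
    by (simp add: y_def)
  have q: "q = q_pow \<tau> 1" "q = y ^ 5"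
    using assms(6) by (simp_all add: y_def q_pow_power) (simp_all add: q_pow_def)
  have q_power: "(y ^ k) ^ 5 = q ^ k" for k
    unfolding q(2) by (simp add: mult.commute flip: power_mult)
  define E G H where "E = (\<lambda>k. qpoch_inf (q ^ k) (q ^ k))"
    and "G = (\<lambda>k. RR_G (q ^ k))" and "H = (\<lambda>k. RR_H (q ^ k))"
  have class_sum: "pent_class_sum (y ^ k) 0 = E k * G k ^ 2"
    "pent_class_sum (y ^ k) 1 = - (E k * (y ^ k * G k * H k))"
    "pent_class_sum (y ^ k) 2 = - (E k * (y ^ k * H k) ^ 2)" for k
    unfolding pent_class_sum_def q_power E_def G_def H_def by (simp_all add: power_mult_distrib)
  have eta: "dedekind_eta (of_nat r * \<tau>) * dedekind_eta (of_nat s * \<tau>) = q_pow \<tau> N * (E r * E s)"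
    unfolding dedekind_eta_product[OF N] E_def q(1) by (simp add: q_pow_power)
  {
    assume rs: "[r + s = 0] (mod 5)"
    hence "5 dvd r + s"
      by (simp add: cong_0_iff)
    moreover from this have "\<not> 5 dvd r"
      using assms(4) dvd_add_right_iff by blast
    ultimately have T: "?T = y ^ N * (pent_class_sum (y ^ r) 0 * pent_class_sum (y ^ s) 0 +
         pent_class_sum (y ^ r) 1 * pent_class_sum (y ^ s) 1 +
         pent_class_sum (y ^ r) 2 * pent_class_sum (y ^ s) 2) +
       y ^ N * (pent_class_sum (y ^ r) 1 * pent_class_sum (y ^ s) 1)"
      unfolding y_def using assms N
      by (intro hecke_T5_eta_product_classes pent_pair_dvd_5_opposite) auto
    have "q ^ ((s + r) div 5) = y ^ r * y ^ s"
      using \<open>5 dvd r + s\<close> unfolding q(2) by (simp add: add.commute flip: power_mult power_add)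
    hence U: "RR_U r s q = G r * G s + y ^ r * y ^ s * H r * H s"
      using rs by (simp add: RR_U_def G_def H_def add.commute)
    \<comment> \<open>Origin of 1/60: N - (r + s) / 30 = N - 24 N / 30 = N / 5.\<close>
    have "real N + 2 * (- (real r + real s) / 60) = real N * (1 / 5)"
      unfolding rsN by simp
    hence "q_pow \<tau> N * q_pow \<tau> (- (real r + real s) / 60) ^ 2 = y ^ N"
      unfolding y_def q_pow_power of_nat_numeral q_pow_add[symmetric] by (rule arg_cong)
    hence "q_pow \<tau> N * (E r * E s) * (q_pow \<tau> (- (real r + real s) / 60) * RR_U r s q) ^ 2 =
        y ^ N * (E r * E s) * RR_U r s q ^ 2"
      by (simp add: power_mult_distrib mult_ac)
    thus "?T = dedekind_eta (of_nat r * \<tau>) * dedekind_eta (of_nat s * \<tau>) *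
        (q_pow \<tau> (- (real r + real s) / 60) * RR_U r s q) ^ 2"
      unfolding T eta class_sum U by (simp add: power2_eq_square algebra_simps)
  next
    assume rs: "[int r - int s = 0] (mod 5)"
    hence "5 dvd int r - int s"
      by (simp add: cong_0_iff)
    hence dvd: "5 dvd int s - int r" and mod5: "r mod 5 = s mod 5"
      using cong_int_iff[of r s 5] by (simp_all add: dvd_diff_commute cong_def mod_eq_dvd_iff)
    hence r5: "\<not> 5 dvd r"
      using assms(4) by (simp add: dvd_eq_mod_eq_0)
    \<comment> \<open>\<open>RR_U\<close> tests the sum first; with r = s modulo 5 that test would
      force 5 to divide 2 r.\<close>
    have nrs: "\<not> [s + r = 0] (mod 5)"
      using mod5 r5 unfolding cong_def by presburger
    have T: "?T = y ^ N * (pent_class_sum (y ^ r) 0 * pent_class_sum (y ^ s) 2 +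
         pent_class_sum (y ^ r) 1 * pent_class_sum (y ^ s) 1 +
         pent_class_sum (y ^ r) 2 * pent_class_sum (y ^ s) 0) +
       y ^ N * (pent_class_sum (y ^ r) 1 * pent_class_sum (y ^ s) 1)"
      unfolding y_def using assms N mod5 r5
      by (intro hecke_T5_eta_product_classes pent_pair_dvd_5_same) auto
    have "q powi ((int s - int r) div 5) = y powi (5 * ((int s - int r) div 5))"
      unfolding q(2) by (simp add: power_int_mult)
    also have "\<dots> = y ^ s / y ^ r"
      using dvd y by (simp add: power_int_diff)
    finally have "RR_U r s q = H r * G s - y ^ s / y ^ r * G r * H s"
      using nrs dvd by (simp add: RR_U_def G_def H_def cong_0_iff)
    \<comment> \<open>The factor y^r clears a possibly negative power of q and makes the two terms
      symmetric; the prefactor of the theorem provides its square.\<close>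
    hence U: "y ^ r * RR_U r s q = y ^ r * H r * G s - y ^ s * G r * H s"
      using y by (simp add: field_simps)
    \<comment> \<open>Origin of the 11: 11 r - s = 12 r - 24 N, so the exponent is N / 5 plus the 2
      r / 5 of (y^r)^2.\<close>
    have "real N + 2 * ((11 * real r - real s) / 60) = real N * (1 / 5) + 2 * (real r * (1 / 5))"
      using rsN by (simp add: field_simps)
    hence "q_pow \<tau> N * q_pow \<tau> ((11 * real r - real s) / 60) ^ 2 = y ^ N * (y ^ r) ^ 2"
      unfolding y_def q_pow_power of_nat_numeral q_pow_add[symmetric]
      by (rule arg_cong)
    hence "q_pow \<tau> N * (E r * E s) * (q_pow \<tau> ((11 * real r - real s) / 60) * RR_U r s q) ^ 2 =
        y ^ N * (E r * E s) * (y ^ r * RR_U r s q) ^ 2"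
      by (simp add: power_mult_distrib mult_ac)
    thus "?T = - (dedekind_eta (of_nat r * \<tau>) * dedekind_eta (of_nat s * \<tau>) *
        (q_pow \<tau> ((11 * real r - real s) / 60) * RR_U r s q) ^ 2)"
      unfolding T eta class_sum U by (simp add: power2_eq_square algebra_simps)
  }
qed

end
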